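(* Let $\omega$ denote the matrix multiplication constant. For every $\varepsilon>0$ and every $d\in[1,k]$, letting $\ell=\max\{n-\frac{k-d}{2},\Delta(G),\mathrm{vc}(G),|S|,\mathrm{mw}(G)\}$, \textsc{Gap LS Vertex Cover} cannot be solved in $\mathcal{O}(\ell^{(\omega/3-\varepsilon)\cdot\frac{k+d}{2}})$ time, unless \textsc{Clique} can be solved in $\mathcal{O}(n^{(\omega/3-\varepsilon)\cdot k})$ time. This holds also for the permissive version of the problem.
   Context: The matrix multiplication constant $\omega$ is the smallest number such that two $n\times n$ matrices can be multiplied in $\mathcal{O}(n^{\omega})$ time. \textsc{Clique}: given an $n$-vertex graph and $k$, decide whether it contains a clique of size $k$. For sets $A,B$, $A\oplus B=(A\setminus B)\cup(B\setminus A)$. A $k$-swap for a vertex cover $S$ of $G=(V,E)$ is $W\subseteq V$ with $|W|\le k$; it is valid if $S\oplus W$ is a vertex cover; it is $d$-improving if $|W\cap S|-|W\setminus S|\ge d$. \textsc{Gap LS Vertex Cover}: given $G$ with $n$ vertices, a vertex cover $S$, $k\in\mathbb{N}$ and $d\in[1,k]$, decide whether a valid $d$-improving $k$-swap for $S$ exists. In the permissive version, an algorithm may either output any vertex cover better than $S$ by the required amount (not necessarily within swap distance $k$) or report that no valid $d$-improving $k$-swap exists. $\Delta(G)$ is the maximum degree, $\mathrm{vc}(G)$ the minimum vertex cover size. A modular decomposition of $G$ is a rooted tree whose leaves correspond bijectively to the vertices of $G$, where each node $x$ is associated with the set $V_x$ of vertices at leaves below it, and each internal node $x$ has a quotient graph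 $\beta(x)$ on its children such that for distinct children $y,z$: $y,z$ adjacent in $\beta(x)$ iff every vertex of $V_y$ is adjacent in $G$ to every vertex of $V_z$, and non-adjacent iff there is no edge between $V_y$ and $V_z$. Its width is the maximum number of vertices of a quotient graph; the modular-width $\mathrm{mw}(G)$ is the minimum width of a modular decomposition of $G$. *)

theory Defs
  imports
    Complex_Main
    "HOL-Library.Landau_Symbols"
    "Jordan_Normal_Form.Matrix"
begin

section \<open>Word RAM\<close>

text \<open>
  Memory cells hold integers and are addressed by integers; all cells are initially 0. The input
  is a read-only random-access array, the output is an append-only list. Every instruction costs
  one time unit. A configuration consists of program counter, memory and output; the machine halts
  when the program counter leaves the program.
\<close>

datatype binop = Add | Sub | Mul | Div | Mod | BitAnd | BitOr | BitXor | Shl | Shr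

fun eval_binop :: "binop \<Rightarrow> int \<Rightarrow> int \<Rightarrow> int" where
  "eval_binop Add x y = x + y"
| "eval_binop Sub x y = x - y"
| "eval_binop Mul x y = x * y"
| "eval_binop Div x y = x div y"
| "eval_binop Mod x y = x mod y"
| "eval_binop BitAnd x y = and x y"
| "eval_binop BitOr x y = or x y"
| "eval_binop BitXor x y = xor x y"
| "eval_binop Shl x y = push_bit (nat y) x"
| "eval_binop Shr x y = drop_bit (nat y) x"

datatype instr =
    Const int int
  | Op binop int int int
  | Load int int
  | Store int int
  | Read int int
  | Write int
  | JumpPos int nat

type_synonym config = "nat \<times> (int \<Rightarrow> int) \<times> int list"

fun exec_instr :: "int list \<Rightarrow> instr \<Rightarrow> config \<Rightarrow> config" where
  "exec_instr inp (Const a c) (pc, M, out) = (Suc pc, M(a := c), out)"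
| "exec_instr inp (Op f a b c) (pc, M, out) = (Suc pc, M(a := eval_binop f (M b) (M c)), out)"
| "exec_instr inp (Load a b) (pc, M, out) = (Suc pc, M(a := M (M b)), out)"
| "exec_instr inp (Store a b) (pc, M, out) = (Suc pc, M(M a := M b), out)"
| "exec_instr inp (Read a b) (pc, M, out) =
     (Suc pc, M(a := (if 0 \<le> M b \<and> M b < int (length inp) then inp ! nat (M b) else 0)), out)"
| "exec_instr inp (Write a) (pc, M, out) = (Suc pc, M, out @ [M a])"
| "exec_instr inp (JumpPos a l) (pc, M, out) = (if M a > 0 then l else Suc pc, M, out)"

definition halted :: "instr list \<Rightarrow> config \<Rightarrow> bool" where
  "halted p cf \<longleftrightarrow> length p \<le> fst cf"

definition step :: "instr list \<Rightarrow> int list \<Rightarrow> config \<Rightarrow> config" where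
  "step p inp cf = (if halted p cf then cf else exec_instr inp (p ! fst cf) cf)"

definition config_after :: "instr list \<Rightarrow> int list \<Rightarrow> nat \<Rightarrow> config" where
  "config_after p inp t = (step p inp ^^ t) (0, \<lambda>_. 0, [])"

definition terminates :: "instr list \<Rightarrow> int list \<Rightarrow> bool" where
  "terminates p inp \<longleftrightarrow> (\<exists>t. halted p (config_after p inp t))"

definition run_time :: "instr list \<Rightarrow> int list \<Rightarrow> nat" where
  "run_time p inp = (LEAST t. halted p (config_after p inp t))"

definition result :: "instr list \<Rightarrow> int list \<Rightarrow> int list" where
  "result p inp = snd (snd (config_after p inp (run_time p inp)))"

definition input_size :: "int list \<Rightarrow> nat" where
  "input_size inp = length inp + nat (Max (insert 0 (abs ` set inp)))"

text \<open>
  The word-length restriction: with input size \<open>N\<close> and running time \<open>t\<close>, words have at most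
  \<open>c * log (N + t + 2)\<close> bits, where the constant \<open>c\<close> may depend on the program. Without it,
  unit-cost multiplication would be unrealistically powerful.
\<close>

definition word_bounded :: "nat \<Rightarrow> instr list \<Rightarrow> int list \<Rightarrow> bool" where
  "word_bounded c p inp \<longleftrightarrow>
     (\<forall>t a. \<bar>fst (snd (config_after p inp t)) a\<bar> \<le> int ((input_size inp + run_time p inp + 2) ^ c))"

section \<open>Problems and solvability in time \<open>O(f)\<close>\<close>

text \<open>
  \<open>correct x out\<close>: the list \<open>out\<close> is an admissible answer on the instance \<open>x\<close>.
\<close>

record 'i problem =
  instances :: "'i set"
  encode :: "'i \<Rightarrow> int list"
  dimension :: "'i \<Rightarrow> nat"
  correct :: "'i \<Rightarrow> int list \<Rightarrow> bool"

text \<open>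
  The \<open>O\<close>-bound is taken as the dimension (number of vertices, number of matrix rows) tends to
  infinity. Its constant is uniform over all instances, whatever their other parameters.
\<close>

definition large_instances :: "'i problem \<Rightarrow> 'i filter" where
  "large_instances P = inf (filtercomap (dimension P) at_top) (principal (instances P))"

definition solvable_in_time :: "'i problem \<Rightarrow> ('i \<Rightarrow> real) \<Rightarrow> bool" where
  "solvable_in_time P f \<longleftrightarrow>
     (\<exists>p c. (\<forall>x\<in>instances P.
                terminates p (encode P x) \<and>
                word_bounded c p (encode P x) \<and>
                correct P x (result p (encode P x))) \<and>
            (\<lambda>x. real (run_time p (encode P x))) \<in> O[large_instances P](f))"

definition decides :: "bool \<Rightarrow> int list \<Rightarrow> bool" where
  "decides b out \<longleftrightarrow> out = [if b then 1 else 0]"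

section \<open>The matrix multiplication constant\<close>

definition matrix_mult_problem :: "(nat \<times> int mat \<times> int mat) problem" where
  "matrix_mult_problem =
     \<lparr>instances = {(n, A, B). A \<in> carrier_mat n n \<and> B \<in> carrier_mat n n},
      encode = (\<lambda>(n, A, B). int n # concat (mat_to_list A) @ concat (mat_to_list B)),
      dimension = (\<lambda>(n, A, B). n),
      correct = (\<lambda>(n, A, B) out. out = concat (mat_to_list (A * B)))\<rparr>"

definition omega :: real where
  "omega = Inf {\<tau>. solvable_in_time matrix_mult_problem (\<lambda>(n, A, B). real n powr \<tau>)}"

section \<open>Graphs\<close>

definition simple_graph :: "'a set \<Rightarrow> 'a set set \<Rightarrow> bool" where
  "simple_graph V E \<longleftrightarrow> finite V \<and> (\<forall>e\<in>E. e \<subseteq> V \<and> card e = 2)"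

definition is_clique :: "'a set \<Rightarrow> 'a set set \<Rightarrow> 'a set \<Rightarrow> bool" where
  "is_clique V E C \<longleftrightarrow> C \<subseteq> V \<and> (\<forall>u\<in>C. \<forall>v\<in>C. u \<noteq> v \<longrightarrow> {u, v} \<in> E)"

definition vertex_cover :: "'a set \<Rightarrow> 'a set set \<Rightarrow> 'a set \<Rightarrow> bool" where
  "vertex_cover V E S \<longleftrightarrow> S \<subseteq> V \<and> (\<forall>e\<in>E. e \<inter> S \<noteq> {})"

definition vc :: "'a set \<Rightarrow> 'a set set \<Rightarrow> nat" where
  "vc V E = (LEAST m. \<exists>S. vertex_cover V E S \<and> card S = m)"

definition max_degree :: "'a set \<Rightarrow> 'a set set \<Rightarrow> nat" where
  "max_degree V E = Max ((\<lambda>v. card {u \<in> V. {u, v} \<in> E}) ` V)"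

text \<open>
  \<open>Node ts F\<close> is an internal node with children \<open>ts\<close>; its quotient graph has vertex set
  \<open>{..<length ts}\<close> (the positions of the children) and edge set \<open>F\<close>.
\<close>

datatype 'a mod_tree = Leaf 'a | Node "'a mod_tree list" "nat set set"

fun leaves :: "'a mod_tree \<Rightarrow> 'a list" where
  "leaves (Leaf v) = [v]"
| "leaves (Node ts F) = concat (map leaves ts)"

fun quotients_ok :: "'a set set \<Rightarrow> 'a mod_tree \<Rightarrow> bool" where
  "quotients_ok E (Leaf v) = True"
| "quotients_ok E (Node ts F) =
     (ts \<noteq> [] \<and>
      simple_graph {..<length ts} F \<and>
      (\<forall>i<length ts. \<forall>j<length ts. i \<noteq> j \<longrightarrow>
         ({i, j} \<in> F \<longleftrightarrow>
            (\<forall>u\<in>set (leaves (ts ! i)). \<forall>v\<in>set (leaves (ts ! j)). {u, v} \<in> E)) \<and>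
         ({i, j} \<notin> F \<longleftrightarrow>
            (\<forall>u\<in>set (leaves (ts ! i)). \<forall>v\<in>set (leaves (ts ! j)). {u, v} \<notin> E))) \<and>
      (\<forall>t\<in>set ts. quotients_ok E t))"

fun tree_width :: "'a mod_tree \<Rightarrow> nat" where
  "tree_width (Leaf v) = 0"
| "tree_width (Node ts F) = Max (insert (length ts) (set (map tree_width ts)))"

definition modular_decomposition :: "'a set \<Rightarrow> 'a set set \<Rightarrow> 'a mod_tree \<Rightarrow> bool" where
  "modular_decomposition V E T \<longleftrightarrow>
     distinct (leaves T) \<and> set (leaves T) = V \<and> quotients_ok E T"

definition mw :: "'a set \<Rightarrow> 'a set set \<Rightarrow> nat" where
  "mw V E = (LEAST w. \<exists>T. modular_decomposition V E T \<and> tree_width T = w)"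

text \<open>Input graphs have vertex set \<open>{..<n}\<close> and are given by their adjacency matrix.\<close>

definition adjacency_matrix :: "nat \<Rightarrow> nat set set \<Rightarrow> int list" where
  "adjacency_matrix n E = [if {i, j} \<in> E then 1 else 0. i \<leftarrow> [0..<n], j \<leftarrow> [0..<n]]"

section \<open>Clique\<close>

text \<open>
  Instances \<open>(n, E, k)\<close>, with \<open>k\<close> restricted to a set \<open>K\<close> of clique sizes:
  \<open>K = UNIV\<close> is the unrestricted problem, \<open>K = {k}\<close> the problem for one fixed \<open>k\<close>.
\<close>

definition clique_problem :: "nat set \<Rightarrow> (nat \<times> nat set set \<times> nat) problem" where
  "clique_problem K =
     \<lparr>instances = {(n, E, k). simple_graph {..<n} E \<and> k \<in> K},
      encode = (\<lambda>(n, E, k). [int n, int k] @ adjacency_matrix n E),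
      dimension = (\<lambda>(n, E, k). n),
      correct = (\<lambda>(n, E, k). decides (\<exists>C. is_clique {..<n} E C \<and> card C = k))\<rparr>"

section \<open>Gap LS Vertex Cover\<close>

definition k_swap :: "'a set \<Rightarrow> nat \<Rightarrow> 'a set \<Rightarrow> bool" where
  "k_swap V k W \<longleftrightarrow> W \<subseteq> V \<and> card W \<le> k"

definition valid_swap :: "'a set \<Rightarrow> 'a set set \<Rightarrow> 'a set \<Rightarrow> 'a set \<Rightarrow> bool" where
  "valid_swap V E S W \<longleftrightarrow> vertex_cover V E (sym_diff S W)"

definition improving_swap :: "nat \<Rightarrow> 'a set \<Rightarrow> 'a set \<Rightarrow> bool" where
  "improving_swap d S W \<longleftrightarrow> int (card (W \<inter> S)) - int (card (W - S)) \<ge> int d"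

definition has_improving_swap ::
  "'a set \<Rightarrow> 'a set set \<Rightarrow> 'a set \<Rightarrow> nat \<Rightarrow> nat \<Rightarrow> bool" where
  "has_improving_swap V E S k d \<longleftrightarrow>
     (\<exists>W. k_swap V k W \<and> valid_swap V E S W \<and> improving_swap d S W)"

type_synonym gap_instance = "nat \<times> nat set set \<times> nat set \<times> nat \<times> nat"

text \<open>
  Instances \<open>(n, E, S, k, d)\<close>, with the parameters \<open>(k, d)\<close> restricted to a set \<open>Q\<close>.
\<close>

definition gap_instances :: "(nat \<times> nat) set \<Rightarrow> gap_instance set" where
  "gap_instances Q = {(n, E, S, k, d). simple_graph {..<n} E \<and> vertex_cover {..<n} E S \<and>
                                       1 \<le> d \<and> d \<le> k \<and> (k, d) \<in> Q}"

definition gap_encode :: "gap_instance \<Rightarrow> int list" where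
  "gap_encode = (\<lambda>(n, E, S, k, d).
     [int n, int k, int d] @ [if i \<in> S then 1 else 0. i \<leftarrow> [0..<n]] @ adjacency_matrix n E)"

definition gap_ls_vertex_cover :: "(nat \<times> nat) set \<Rightarrow> gap_instance problem" where
  "gap_ls_vertex_cover Q =
     \<lparr>instances = gap_instances Q,
      encode = gap_encode,
      dimension = (\<lambda>(n, E, S, k, d). n),
      correct = (\<lambda>(n, E, S, k, d). decides (has_improving_swap {..<n} E S k d))\<rparr>"

text \<open>
  In the permissive version the answer is either \<open>[0]\<close>, claiming that no valid \<open>d\<close>-improving
  \<open>k\<close>-swap exists, or 1 followed by the vertices of a cover that is smaller than \<open>S\<close> by at
  least \<open>d\<close>.
\<close>

definition permissive_gap_ls_vertex_cover :: "(nat \<times> nat) set \<Rightarrow> gap_instance problem" where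
  "permissive_gap_ls_vertex_cover Q =
     \<lparr>instances = gap_instances Q,
      encode = gap_encode,
      dimension = (\<lambda>(n, E, S, k, d). n),
      correct = (\<lambda>(n, E, S, k, d) out.
        (out = [0] \<and> \<not> has_improving_swap {..<n} E S k d) \<or>
        (\<exists>xs. out = 1 # map int xs \<and> distinct xs \<and> vertex_cover {..<n} E (set xs) \<and>
              int (card S) - int (card (set xs)) \<ge> int d))\<rparr>"

definition ell :: "gap_instance \<Rightarrow> real" where
  "ell = (\<lambda>(n, E, S, k, d).
     Max {real n - (real k - real d) / 2,
          real (max_degree {..<n} E),
          real (vc {..<n} E),
          real (card S),
          real (mw {..<n} E)})"

end

theory Submission
  imports Defs
begin

text \<open>
  A clique instance \<open>(n, E, k')\<close> becomes the gap instance consisting of the complement graph and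
  \<open>k' - d\<close> new independent vertices joined to all old ones, with the old vertices as the cover
  \<open>S\<close>. Every cover smaller than \<open>S\<close> contains all new vertices, so it beats \<open>S\<close> by \<open>d\<close> only if it
  omits \<open>k'\<close> old vertices, and these form a clique.

  Put \<open>c = omega / 3 - \<epsilon>\<close>; only its sign matters. Writing down the new graph takes quadratic
  time, which the bound \<open>n powr (c * k')\<close> need not
  allow. The clique algorithm therefore simulates the gap algorithm and computes each input word
  when it is read. The bound on \<open>ell\<close> has to be \<open>n\<close> without a constant factor when \<open>k'\<close> is
  unbounded; this is achieved by isolating the vertices of degree below \<open>k' - 1\<close>. Finding
  them takes quadratic time and is only done if \<open>c * k' \<ge> 2\<close> is guaranteed; otherwise \<open>k'\<close> is
  bounded, and \<open>ell \<le> 2 * n\<close> suffices. For \<open>c < 0\<close> a gap algorithm would have to stop after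
  0 steps and could not produce any output.
\<close>

section \<open>Compiling structured programs to the word RAM\<close>

text \<open>The numbers are forced by the swap: for a clique of size \<open>k'\<close> it moves
  \<open>k'\<close> vertices out of \<open>S\<close> and the \<open>k' - d\<close> new ones in, so
  its size is \<open>k = 2 * k' - d\<close>, its gain is \<open>d\<close>, and
  \<open>(k + d) / 2 = k'\<close>. The graph has \<open>n + (k' - d)\<close> vertices, which the
  term \<open>(k - d) / 2\<close> in \<open>ell\<close> brings back to exactly \<open>n\<close>.
  What remains is the degree: an old vertex may have up to \<open>n - 1\<close> neighbours in the
  complement plus \<open>k' - d\<close> new ones. Settling for \<open>ell \<le> 2 * n\<close> costs
  a factor \<open>2 powr (c * k')\<close>, which is harmless only while \<open>k'\<close> is
  bounded, as the \<open>O\<close>-constant is uniform in \<open>k'\<close>. A vertex with at least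
  \<open>k' - 1\<close> neighbours in the input graph loses these in the complement, which makes
  room for the new ones.

  The word-length restriction shapes the machine part. The words of the simulator must be polynomial
  in its own input size and running time. So every layer tracks a bound on all memory contents, and
  also a lower bound on the time: the words of the simulated program may grow with its running time,
  and the simulator must run at least as long.\<close>

definition code_at :: "instr list \<Rightarrow> nat \<Rightarrow> instr list \<Rightarrow> bool" where
  "code_at P i xs \<longleftrightarrow> (\<forall>j<length xs. i + j < length P \<and> P ! (i + j) = xs ! j)"

lemma code_at_Nil [simp]: "code_at P i []"
  by (simp add: code_at_def)

lemma code_at_Cons [simp]:
  "code_at P i (x # xs) \<longleftrightarrow> i < length P \<and> P ! i = x \<and> code_at P (Suc i) xs"
  unfolding code_at_def by (auto simp: less_Suc_eq_0_disj nth_Cons split: nat.splits)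

lemma code_at_append [simp]:
  "code_at P i (xs @ ys) \<longleftrightarrow> code_at P i xs \<and> code_at P (i + length xs) ys"
  by (induction xs arbitrary: i) auto

lemma code_at_self: "code_at P 0 P"
  by (simp add: code_at_def)

definition bounded_by :: "int \<Rightarrow> (int \<Rightarrow> int) \<Rightarrow> bool" where
  "bounded_by B M \<longleftrightarrow> (\<forall>a. \<bar>M a\<bar> \<le> B)"

lemma bounded_by_upd: "bounded_by B M \<Longrightarrow> \<bar>x\<bar> \<le> B \<Longrightarrow> bounded_by B (M(a := x))"
  by (simp add: bounded_by_def)

text \<open>Excluding halted configurations before step \<open>t\<close> makes \<open>t\<close> the
  exact running time once the last configuration is halted. The bound is demanded at every
  intermediate time because the word-length restriction is.\<close>

definition reach :: "instr list \<Rightarrow> int list \<Rightarrow> int \<Rightarrow> config \<Rightarrow> nat \<Rightarrow> config \<Rightarrow> bool" where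
  "reach P inp B cf t cf' \<longleftrightarrow>
     (step P inp ^^ t) cf = cf' \<and>
     (\<forall>s<t. \<not> halted P ((step P inp ^^ s) cf)) \<and>
     (\<forall>s\<le>t. bounded_by B (fst (snd ((step P inp ^^ s) cf))))"

lemma reach_refl: "bounded_by B M \<Longrightarrow> reach P inp B (pc, M, out) 0 (pc, M, out)"
  by (simp add: reach_def)

lemma reach_bounded: "reach P inp B cf t (pc, M, out) \<Longrightarrow> bounded_by B M"
  by (force simp: reach_def)

lemma reach_trans:
  assumes "reach P inp B cf t cf'" "reach P inp B cf' t' cf''"
  shows "reach P inp B cf (t + t') cf''"
proof -
  have split: "(step P inp ^^ s) cf = (step P inp ^^ (s - t)) cf'" if "t \<le> s" for s
  proof -
    have "(step P inp ^^ s) cf = (step P inp ^^ (s - t + t)) cf" using that by simp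
    then show ?thesis using assms(1) unfolding reach_def funpow_add by simp
  qed
  show ?thesis
    unfolding reach_def
  proof (intro conjI allI impI)
    show "(step P inp ^^ (t + t')) cf = cf''"
      using split[of "t + t'"] assms(2) by (simp add: reach_def)
  next
    fix s assume "s < t + t'"
    then show "\<not> halted P ((step P inp ^^ s) cf)"
      using assms split[of s] unfolding reach_def by (cases "s < t") auto
  next
    fix s assume "s \<le> t + t'"
    then show "bounded_by B (fst (snd ((step P inp ^^ s) cf)))"
      using assms split[of s] unfolding reach_def by (cases "s \<le> t") auto
  qed
qed

lemma reach_instr:
  assumes "code_at P pc [i]" "bounded_by B M" "exec_instr inp i (pc, M, out) = (pc', M', out')"
    and "bounded_by B M'"
  shows "reach P inp B (pc, M, out) 1 (pc', M', out')"
  using assms by (auto simp: reach_def step_def halted_def le_Suc_eq)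

section \<open>Expressions: size bounds and compilation\<close>

datatype arith = APlus | AMinus | ATimes | ADiv | AMod

fun arith_op :: "arith \<Rightarrow> binop" where
  "arith_op APlus = Add"
| "arith_op AMinus = Sub"
| "arith_op ATimes = Mul"
| "arith_op ADiv = Div"
| "arith_op AMod = Mod"

datatype exp = Num int | Bin arith exp exp | Mem exp | Inp exp

definition lookup :: "int list \<Rightarrow> int \<Rightarrow> int" where
  "lookup inp x = (if 0 \<le> x \<and> x < int (length inp) then inp ! nat x else 0)"

fun ev :: "int list \<Rightarrow> (int \<Rightarrow> int) \<Rightarrow> exp \<Rightarrow> int" where
  "ev inp H (Num c) = c"
| "ev inp H (Bin f e1 e2) = eval_binop (arith_op f) (ev inp H e1) (ev inp H e2)"
| "ev inp H (Mem e) = H (ev inp H e)"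
| "ev inp H (Inp e) = lookup inp (ev inp H e)"

text \<open>\<open>b ^ weight e\<close> bounds the value of \<open>e\<close> whenever
  \<open>b \<ge> 2\<close> bounds input and memory. A literal weighs its absolute value since
  \<open>m \<le> b ^ m\<close>; the 2 at \<open>Bin\<close> pays for
  \<open>x * y + x + y \<le> 4 * (x * y) \<le> b ^ 2 * (x * y)\<close> with
  \<open>x, y \<ge> 1\<close>.\<close>

fun weight :: "exp \<Rightarrow> nat" where
  "weight (Num c) = nat \<bar>c\<bar>"
| "weight (Bin f e1 e2) = weight e1 + weight e2 + 2"
| "weight (Mem e) = weight e + 1"
| "weight (Inp e) = weight e + 1"

lemma abs_div_le: "\<bar>(x::int) div y\<bar> \<le> \<bar>x\<bar>"
proof (cases "y = 0")
  case False
  have 1: "\<bar>a div b\<bar> \<le> \<bar>a\<bar>" if "b > 0" for a b :: int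
  proof (cases "a \<ge> 0")
    case True
    then show ?thesis using that zdiv_mono2[of a 1 b] pos_imp_zdiv_nonneg_iff[of b a] by simp
  next
    case False
    then have "a div b < 0" using that by (simp add: neg_imp_zdiv_neg_iff div_neg_pos_less0)
    moreover have "a \<le> a div b"
      using False that zdiv_mono2_neg[of a 1 b] by simp
    ultimately show ?thesis by simp
  qed
  show ?thesis
  proof (cases "y > 0")
    case False
    then have "x div y = (-x) div (-y)" "-y > 0" using \<open>y \<noteq> 0\<close> by auto
    then show ?thesis using 1[of "-y" "-x"] by simp
  qed (use 1 in auto)
qed simp

lemma abs_mod_le: "\<bar>(x::int) mod y\<bar> \<le> \<bar>x\<bar> + \<bar>y\<bar>"
  using pos_mod_bound[of y x] pos_mod_sign[of y x] neg_mod_bound[of y x] neg_mod_sign[of y x]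
  by (cases "y = 0") (simp, linarith)

lemma abs_arith_le:
  "\<bar>eval_binop (arith_op f) x y\<bar> \<le> \<bar>x\<bar> * \<bar>y\<bar> + \<bar>x\<bar> + \<bar>y\<bar>"
proof -
  have nonneg: "0 \<le> \<bar>x\<bar> * \<bar>y\<bar>" "0 \<le> \<bar>x\<bar>" "0 \<le> \<bar>y\<bar>" by simp_all
  show ?thesis
  proof (cases f)
    case F: APlus
    show ?thesis using nonneg abs_triangle_ineq[of x y] unfolding F arith_op.simps eval_binop.simps
      by linarith
  next
    case F: AMinus
    show ?thesis using nonneg abs_triangle_ineq4[of x y] unfolding F arith_op.simps eval_binop.simps
      by linarith
  next
    case F: ATimes
    show ?thesis using nonneg abs_mult[of x y] unfolding F arith_op.simps eval_binop.simps by linarith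
  next
    case F: ADiv
    show ?thesis using nonneg abs_div_le[of x y] unfolding F arith_op.simps eval_binop.simps
      by linarith
  next
    case F: AMod
    show ?thesis using nonneg abs_mod_le[of x y] unfolding F arith_op.simps eval_binop.simps
      by linarith
  qed
qed

lemma abs_le_power: "2 \<le> (b::int) \<Longrightarrow> \<bar>c\<bar> \<le> b ^ nat \<bar>c\<bar>"
proof -
  assume "2 \<le> b"
  have "int m \<le> b ^ m" for m
  proof -
    have "int m \<le> 2 ^ m" using of_nat_less_two_power[of m, where 'a = int] by simp
    also have "\<dots> \<le> b ^ m" using \<open>2 \<le> b\<close> by (simp add: power_mono)
    finally show ?thesis .
  qed
  from this[of "nat \<bar>c\<bar>"] show ?thesis by simp
qed

lemma abs_lookup_le: "\<forall>x\<in>set inp. \<bar>x\<bar> \<le> b \<Longrightarrow> 0 \<le> b \<Longrightarrow> \<bar>lookup inp x\<bar> \<le> b"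
  by (auto simp: lookup_def nat_less_iff)

lemma abs_ev_le:
  assumes "2 \<le> b" "\<forall>x\<in>set inp. \<bar>x\<bar> \<le> b" "bounded_by b H"
  shows "\<bar>ev inp H e\<bar> \<le> b ^ weight e"
proof (induction e)
  case (Num c)
  then show ?case using abs_le_power[OF assms(1)] by simp
next
  case (Bin f e1 e2)
  let ?x = "b ^ weight e1" and ?y = "b ^ weight e2"
  have xy: "1 \<le> ?x" "1 \<le> ?y" using assms(1) by auto
  have "\<bar>ev inp H (Bin f e1 e2)\<bar> \<le> \<bar>ev inp H e1\<bar> * \<bar>ev inp H e2\<bar> + \<bar>ev inp H e1\<bar> + \<bar>ev inp H e2\<bar>"
    using abs_arith_le by simp
  also have "\<dots> \<le> ?x * ?y + ?x + ?y"
    using Bin xy by (intro add_mono mult_mono) auto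
  also have "\<dots> \<le> ?x * ?y + ?x * ?y + ?x * ?y"
    using xy by (intro add_mono) auto
  also have "\<dots> \<le> 4 * (?x * ?y)" using xy by simp
  also have "\<dots> \<le> b ^ 2 * (?x * ?y)"
    using assms(1) power_mono[of 2 b 2] xy by (intro mult_right_mono) auto
  finally show ?case by (simp add: power_add mult_ac power2_eq_square)
next
  case (Mem e)
  have "b \<le> b ^ weight (Mem e)" using assms(1) self_le_power[of b "weight (Mem e)"] by simp
  then show ?case using assms(3) unfolding bounded_by_def ev.simps by (blast intro: order_trans)
next
  case (Inp e)
  have "b \<le> b ^ weight (Inp e)" using assms(1) self_le_power[of b "weight (Inp e)"] by simp
  moreover have "\<bar>ev inp H (Inp e)\<bar> \<le> b" using abs_lookup_le[OF assms(2)] assms(1) by simp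
  ultimately show ?case by linarith
qed

text \<open>
  Cell \<open>a\<close> of the structured language is cell \<open>2 * a\<close> of the machine; the odd cells hold
  intermediate results.
\<close>

definition temp :: "nat \<Rightarrow> int" where
  "temp r = 2 * int r + 1"

lemma temp_eq_iff [simp]: "temp r = temp s \<longleftrightarrow> r = s"
  by (simp add: temp_def)

lemma upd_temp: "s < r \<Longrightarrow> (M(temp r := x)) (temp s) = M (temp s)"
  by simp

lemma double_neq_temp [simp]: "2 * a \<noteq> temp r" "temp r \<noteq> 2 * a"
  unfolding temp_def by presburger+

text \<open>\<open>r\<close> is the height of an evaluation stack: the value ends in
  \<open>temp r\<close>, and all lower temporaries survive. \<open>Mem\<close> adds the address to
  itself because cell \<open>a\<close> lives in machine cell \<open>2 * a\<close>.\<close>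

fun comp_exp :: "nat \<Rightarrow> exp \<Rightarrow> instr list" where
  "comp_exp r (Num c) = [Const (temp r) c]"
| "comp_exp r (Bin f e1 e2) =
     comp_exp r e1 @ comp_exp (Suc r) e2 @ [Op (arith_op f) (temp r) (temp r) (temp (Suc r))]"
| "comp_exp r (Mem e) = comp_exp r e @ [Op Add (temp r) (temp r) (temp r), Load (temp r) (temp r)]"
| "comp_exp r (Inp e) = comp_exp r e @ [Read (temp r) (temp r)]"

definition represents :: "(int \<Rightarrow> int) \<Rightarrow> (int \<Rightarrow> int) \<Rightarrow> bool" where
  "represents M H \<longleftrightarrow> (\<forall>a. M (2 * a) = H a)"

lemma represents_temp [simp]: "represents (M(temp r := x)) H \<longleftrightarrow> represents M H"
  by (simp add: represents_def)

lemma represents_upd: "represents M H \<Longrightarrow> represents (M(2 * a := x)) (H(a := x))"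
  by (simp add: represents_def)

text \<open>Doubled addresses are machine words that occur as values of no subexpression; one more
  unit in the exponent absorbs the factor 2.\<close>

lemma double_le_power:
  fixes b x :: int
  assumes "2 \<le> b" "\<bar>x\<bar> \<le> b ^ v" "v < w"
  shows "\<bar>x + x\<bar> \<le> b ^ w"
proof -
  have "\<bar>x + x\<bar> \<le> 2 * b ^ v" using assms(2) by simp
  also have "\<dots> \<le> b ^ Suc v" using assms(1) by simp
  also have "\<dots> \<le> b ^ w" using assms by (intro power_increasing) auto
  finally show ?thesis .
qed

text \<open>Two bounds are at work: structured memory stays below \<open>b\<close>, while
  temporaries may reach \<open>b ^ w\<close>. Preservation of the temporaries below \<open>r\<close>
  lets \<open>Bin\<close> find its first operand again after the second has been evaluated.\<close>

lemma comp_exp_correct: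
  assumes b: "2 \<le> b" "\<forall>x\<in>set inp. \<bar>x\<bar> \<le> b" "bounded_by b H"
  shows "code_at P i (comp_exp r e) \<Longrightarrow> represents M H \<Longrightarrow> bounded_by (b ^ w) M \<Longrightarrow>
    weight e \<le> w \<Longrightarrow>
    \<exists>M'. reach P inp (b ^ w) (i, M, out) (length (comp_exp r e))
                (i + length (comp_exp r e), M', out) \<and>
         represents M' H \<and> M' (temp r) = ev inp H e \<and> (\<forall>s<r. M' (temp s) = M (temp s))"
proof (induction e arbitrary: i r M)
  case (Num c)
  have "\<bar>c\<bar> \<le> b ^ w"
    using abs_ev_le[OF b, of "Num c"] power_increasing[OF Num(4), of b] b(1) by (simp only: ev.simps) linarith
  then have "reach P inp (b ^ w) (i, M, out) 1 (Suc i, M(temp r := c), out)"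
    using Num by (intro reach_instr) (auto intro: bounded_by_upd)
  with Num show ?case
    by (intro exI[of _ "M(temp r := c)"] conjI) (simp_all add: upd_temp fun_upd_same del: fun_upd_apply)
next
  case (Bin f e1 e2)
  let ?i1 = "i + length (comp_exp r e1)"
  let ?i2 = "?i1 + length (comp_exp (Suc r) e2)"
  let ?v = "ev inp H (Bin f e1 e2)"
  obtain M1 where M1: "reach P inp (b ^ w) (i, M, out) (length (comp_exp r e1)) (?i1, M1, out)"
    "represents M1 H" "M1 (temp r) = ev inp H e1" "\<forall>s<r. M1 (temp s) = M (temp s)"
    using Bin.IH(1)[of i r M] Bin.prems by auto
  obtain M2 where M2: "reach P inp (b ^ w) (?i1, M1, out) (length (comp_exp (Suc r) e2)) (?i2, M2, out)"
    "represents M2 H" "M2 (temp (Suc r)) = ev inp H e2" "\<forall>s<Suc r. M2 (temp s) = M1 (temp s)"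
    using Bin.IH(2)[of ?i1 "Suc r" M1] Bin.prems M1 reach_bounded by auto
  have "\<bar>?v\<bar> \<le> b ^ w"
    using abs_ev_le[OF b, of "Bin f e1 e2"] power_increasing[OF Bin.prems(4), of b] b(1) by linarith
  then have "reach P inp (b ^ w) (?i2, M2, out) 1 (Suc ?i2, M2(temp r := ?v), out)"
    using Bin.prems M1 M2 reach_bounded[OF M2(1)] by (intro reach_instr) (auto intro: bounded_by_upd)
  from reach_trans[OF reach_trans[OF M1(1) M2(1)] this] show ?case
    using M1 M2 by (intro exI[of _ "M2(temp r := ?v)"]) (auto simp: upd_temp fun_upd_same add_ac simp del: fun_upd_apply)
next
  case (Mem e)
  let ?i1 = "i + length (comp_exp r e)"
  let ?v = "ev inp H e"
  obtain M1 where M1: "reach P inp (b ^ w) (i, M, out) (length (comp_exp r e)) (?i1, M1, out)"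
    "represents M1 H" "M1 (temp r) = ?v" "\<forall>s<r. M1 (temp s) = M (temp s)"
    using Mem.IH[of i r M] Mem.prems by auto
  have "\<bar>?v + ?v\<bar> \<le> b ^ w"
    using double_le_power[OF b(1) abs_ev_le[OF b, of e]] Mem.prems(4) by simp
  then have 1: "reach P inp (b ^ w) (?i1, M1, out) 1 (Suc ?i1, M1(temp r := 2 * ?v), out)"
    using Mem.prems M1 reach_bounded[OF M1(1)] by (intro reach_instr) (auto intro: bounded_by_upd)
  have "\<bar>ev inp H (Mem e)\<bar> \<le> b ^ w"
    using abs_ev_le[OF b, of "Mem e"] power_increasing[OF Mem.prems(4), of b] b(1) by linarith
  then have 2: "reach P inp (b ^ w) (Suc ?i1, M1(temp r := 2 * ?v), out) 1
      (Suc (Suc ?i1), M1(temp r := H ?v), out)"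
    using Mem.prems M1 reach_bounded[OF 1]
    by (intro reach_instr) (auto intro: bounded_by_upd[OF reach_bounded[OF M1(1)]] simp: represents_def)
  from reach_trans[OF reach_trans[OF M1(1) 1] 2] show ?case
    using M1 by (intro exI[of _ "M1(temp r := H ?v)"]) (auto simp: upd_temp fun_upd_same add_ac simp del: fun_upd_apply)
next
  case (Inp e)
  let ?i1 = "i + length (comp_exp r e)"
  let ?v = "ev inp H (Inp e)"
  obtain M1 where M1: "reach P inp (b ^ w) (i, M, out) (length (comp_exp r e)) (?i1, M1, out)"
    "represents M1 H" "M1 (temp r) = ev inp H e" "\<forall>s<r. M1 (temp s) = M (temp s)"
    using Inp.IH[of i r M] Inp.prems by auto
  have "\<bar>?v\<bar> \<le> b ^ w"
    using abs_ev_le[OF b, of "Inp e"] power_increasing[OF Inp.prems(4), of b] b(1) by linarith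
  then have 1: "reach P inp (b ^ w) (?i1, M1, out) 1 (Suc ?i1, M1(temp r := ?v), out)"
    using Inp.prems M1 reach_bounded[OF M1(1)]
    by (intro reach_instr) (auto intro: bounded_by_upd simp: lookup_def)
  from reach_trans[OF M1(1) 1] show ?case
    using M1 by (intro exI[of _ "M1(temp r := ?v)"]) (auto simp: upd_temp fun_upd_same add_ac simp del: fun_upd_apply)
qed

section \<open>Commands: big-step semantics and compilation\<close>

datatype com = Skip | Asg exp exp | Bop binop int int int | Out exp
  | Seq com com | Cond exp com com | Loop exp com

text \<open>Only stored values must respect \<open>b\<close>; intermediate values are controlled by
  \<open>weight\<close>. \<open>Bop\<close> is separate from \<open>Asg\<close> because it must
  execute any simulated operation, including shifts, whose results have no polynomial bound in the
  operands. Time counts assignments, outputs and tests; the fixed cost of evaluating an expression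
  is left to \<open>cost\<close>.\<close>

inductive big :: "int list \<Rightarrow> int \<Rightarrow> com \<Rightarrow> (int \<Rightarrow> int) \<Rightarrow> int list \<Rightarrow> nat \<Rightarrow>
    (int \<Rightarrow> int) \<Rightarrow> int list \<Rightarrow> bool" for inp b where
  big_Skip: "big inp b Skip H out 0 H out"
| big_Asg: "\<bar>ev inp H e2\<bar> \<le> b \<Longrightarrow> big inp b (Asg e1 e2) H out 1 (H(ev inp H e1 := ev inp H e2)) out"
| big_Bop: "\<bar>eval_binop f (H y) (H z)\<bar> \<le> b \<Longrightarrow>
    big inp b (Bop f x y z) H out 1 (H(x := eval_binop f (H y) (H z))) out"
| big_Out: "big inp b (Out e) H out 1 H (out @ [ev inp H e])"
| big_Seq: "big inp b c1 H out t1 H1 out1 \<Longrightarrow> big inp b c2 H1 out1 t2 H2 out2 \<Longrightarrow>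
    big inp b (Seq c1 c2) H out (t1 + t2) H2 out2"
| big_CondT: "ev inp H e > 0 \<Longrightarrow> big inp b c1 H out t H1 out1 \<Longrightarrow>
    big inp b (Cond e c1 c2) H out (t + 1) H1 out1"
| big_CondF: "\<not> ev inp H e > 0 \<Longrightarrow> big inp b c2 H out t H1 out1 \<Longrightarrow>
    big inp b (Cond e c1 c2) H out (t + 1) H1 out1"
| big_LoopT: "ev inp H e > 0 \<Longrightarrow> big inp b c H out t1 H1 out1 \<Longrightarrow>
    big inp b (Loop e c) H1 out1 t2 H2 out2 \<Longrightarrow> big inp b (Loop e c) H out (t1 + t2 + 1) H2 out2"
| big_LoopF: "\<not> ev inp H e > 0 \<Longrightarrow> big inp b (Loop e c) H out 1 H out"

lemma big_bounded: "big inp b c H out t H' out' \<Longrightarrow> bounded_by b H \<Longrightarrow> bounded_by b H'"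
  by (induction rule: big.induct) (auto intro: bounded_by_upd)

text \<open>Jump targets are absolute, hence the start address \<open>i\<close>. An unconditional
  jump loads 1 into \<open>temp 0\<close> before \<open>JumpPos\<close>. The else branch comes first
  because \<open>JumpPos\<close> falls through on a non-positive value.\<close>

fun comp_com :: "nat \<Rightarrow> com \<Rightarrow> instr list" where
  "comp_com i Skip = []"
| "comp_com i (Asg e1 e2) =
     comp_exp 0 e1 @ [Op Add (temp 0) (temp 0) (temp 0)] @ comp_exp 1 e2 @ [Store (temp 0) (temp 1)]"
| "comp_com i (Bop f x y z) = [Op f (2 * x) (2 * y) (2 * z)]"
| "comp_com i (Out e) = comp_exp 0 e @ [Write (temp 0)]"
| "comp_com i (Seq c1 c2) = (let xs = comp_com i c1 in xs @ comp_com (i + length xs) c2)"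
| "comp_com i (Cond e c1 c2) =
     (let l = i + length (comp_exp 0 e) + 1;
          ys = comp_com l c2;
          m = l + length ys + 2;
          xs = comp_com m c1
      in comp_exp 0 e @ [JumpPos (temp 0) m] @ ys @
         [Const (temp 0) 1, JumpPos (temp 0) (m + length xs)] @ xs)"
| "comp_com i (Loop e c) =
     (let l = i + length (comp_exp 0 e) + 3;
          xs = comp_com l c
      in comp_exp 0 e @ [JumpPos (temp 0) l, Const (temp 0) 1, JumpPos (temp 0) (l + length xs + 2)] @
         xs @ [Const (temp 0) 1, JumpPos (temp 0) i])"

text \<open>Bounds the machine steps per unit of big-step time. Summing over all subcommands is
  wasteful but yields a single factor for the whole run, independent of the input.\<close>

fun cost :: "com \<Rightarrow> nat" where
  "cost Skip = 0"
| "cost (Asg e1 e2) = length (comp_exp 0 e1) + length (comp_exp 1 e2) + 2"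
| "cost (Bop f x y z) = 1"
| "cost (Out e) = length (comp_exp 0 e) + 1"
| "cost (Seq c1 c2) = cost c1 + cost c2"
| "cost (Cond e c1 c2) = length (comp_exp 0 e) + 3 + cost c1 + cost c2"
| "cost (Loop e c) = length (comp_exp 0 e) + 3 + cost c"

fun com_weight :: "com \<Rightarrow> nat" where
  "com_weight Skip = 0"
| "com_weight (Asg e1 e2) = weight e1 + weight e2 + 1"
| "com_weight (Bop f x y z) = 1"
| "com_weight (Out e) = weight e"
| "com_weight (Seq c1 c2) = com_weight c1 + com_weight c2"
| "com_weight (Cond e c1 c2) = weight e + com_weight c1 + com_weight c2"
| "com_weight (Loop e c) = weight e + com_weight c"

lemma reach_jump:
  assumes "code_at P i [Const (temp 0) 1, JumpPos (temp 0) l]" "bounded_by B M" "1 \<le> B"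
  shows "reach P inp B (i, M, out) 2 (l, M(temp 0 := 1), out)"
proof -
  have b: "bounded_by B (M(temp 0 := 1))" using assms by (intro bounded_by_upd) auto
  have "reach P inp B (i, M, out) 1 (Suc i, M(temp 0 := 1), out)"
    using assms b by (intro reach_instr) auto
  moreover have "reach P inp B (Suc i, M(temp 0 := 1), out) 1 (l, M(temp 0 := 1), out)"
    using assms b by (intro reach_instr) auto
  ultimately show ?thesis using reach_trans by (metis one_add_one)
qed

text \<open>One exponent \<open>w\<close> for the entire program lets the bounds of subprograms
  compose; \<open>0 < w\<close> gives \<open>b \<le> b ^ w\<close>, which covers stored values. The
  lower bound \<open>t \<le> t'\<close> is carried along because the word bound of the compiled
  program is measured against its own running time.\<close>

lemma comp_com_correct:
  assumes "big inp b c H out t H' out'"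
    and "2 \<le> b" "\<forall>x\<in>set inp. \<bar>x\<bar> \<le> b"
    and "bounded_by b H" "code_at P i (comp_com i c)" "represents M H" "bounded_by (b ^ w) M"
    and "com_weight c \<le> w" "0 < w"
  shows "\<exists>t' M'. t \<le> t' \<and> t' \<le> cost c * t \<and>
    reach P inp (b ^ w) (i, M, out) t' (i + length (comp_com i c), M', out') \<and> represents M' H'"
  using assms
proof (induction arbitrary: i M rule: big.induct)
  case (big_Skip H out)
  then show ?case using reach_refl by fastforce
next
  case (big_Asg H e2 e1 out)
  let ?x = "ev inp H e1" and ?y = "ev inp H e2"
  let ?i1 = "i + length (comp_exp 0 e1)"
  let ?i2 = "Suc ?i1 + length (comp_exp 1 e2)"
  note b = big_Asg.prems(1-3)
  obtain M1 where M1: "reach P inp (b ^ w) (i, M, out) (length (comp_exp 0 e1)) (?i1, M1, out)"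
    "represents M1 H" "M1 (temp 0) = ?x"
    using comp_exp_correct[OF b, of P i 0 e1 M w out] big_Asg.prems by auto
  have "\<bar>?x + ?x\<bar> \<le> b ^ w"
    using double_le_power[OF b(1) abs_ev_le[OF b, of e1]] big_Asg.prems(7) by simp
  then have 1: "reach P inp (b ^ w) (?i1, M1, out) 1 (Suc ?i1, M1(temp 0 := 2 * ?x), out)"
    using big_Asg.prems M1 reach_bounded[OF M1(1)] by (intro reach_instr) (auto intro: bounded_by_upd)
  obtain M2 where M2: "reach P inp (b ^ w) (Suc ?i1, M1(temp 0 := 2 * ?x), out)
      (length (comp_exp 1 e2)) (?i2, M2, out)"
    "represents M2 H" "M2 (temp 1) = ?y" "M2 (temp 0) = 2 * ?x"
    using comp_exp_correct[OF b, of P "Suc ?i1" 1 e2 "M1(temp 0 := 2 * ?x)" w out] big_Asg.prems M1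
      reach_bounded[OF 1] by auto
  have "\<bar>?y\<bar> \<le> b ^ w"
    using big_Asg(1) self_le_power[of b w] b(1) big_Asg.prems by linarith
  then have 2: "reach P inp (b ^ w) (?i2, M2, out) 1 (Suc ?i2, M2(2 * ?x := ?y), out)"
    using big_Asg.prems M2 reach_bounded[OF M2(1)] by (intro reach_instr) (auto intro: bounded_by_upd)
  show ?case
    using reach_trans[OF reach_trans[OF reach_trans[OF M1(1) 1] M2(1)] 2] represents_upd[OF M2(2), of ?x ?y]
    by (intro exI[of _ "cost (Asg e1 e2)"] exI[of _ "M2(2 * ?x := ?y)"] conjI)
      (simp_all add: add_ac del: fun_upd_apply)
next
  case (big_Bop f H y z x out)
  let ?v = "eval_binop f (H y) (H z)"
  have "\<bar>?v\<bar> \<le> b ^ w"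
    using big_Bop self_le_power[of b w] by linarith
  then have "reach P inp (b ^ w) (i, M, out) 1 (Suc i, M(2 * x := ?v), out)"
    using big_Bop.prems by (intro reach_instr) (auto intro: bounded_by_upd simp: represents_def)
  then show ?case using represents_upd[OF big_Bop.prems(5), of x ?v]
    by (intro exI[of _ 1] exI[of _ "M(2 * x := ?v)"] conjI) (simp_all del: fun_upd_apply)
next
  case (big_Out e H out)
  let ?i1 = "i + length (comp_exp 0 e)"
  obtain M1 where M1: "reach P inp (b ^ w) (i, M, out) (length (comp_exp 0 e)) (?i1, M1, out)"
    "represents M1 H" "M1 (temp 0) = ev inp H e"
    using comp_exp_correct[OF big_Out.prems(1-3), of P i 0 e M w out] big_Out.prems by auto
  have 1: "reach P inp (b ^ w) (?i1, M1, out) 1 (Suc ?i1, M1, out @ [ev inp H e])"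
    using big_Out.prems M1 reach_bounded[OF M1(1)] by (intro reach_instr) auto
  show ?case using reach_trans[OF M1(1) 1] M1
    by (intro exI[of _ "cost (Out e)"] exI[of _ M1]) auto
next
  case (big_Seq c1 H out t1 H1 out1 c2 t2 H2 out2)
  let ?i1 = "i + length (comp_com i c1)"
  obtain t1' M1 where 1: "t1 \<le> t1'" "t1' \<le> cost c1 * t1"
    "reach P inp (b ^ w) (i, M, out) t1' (?i1, M1, out1)" "represents M1 H1"
    using big_Seq.IH(1)[of i M] big_Seq.prems by (auto simp: Let_def)
  obtain t2' M2 where 2: "t2 \<le> t2'" "t2' \<le> cost c2 * t2"
    "reach P inp (b ^ w) (?i1, M1, out1) t2' (?i1 + length (comp_com ?i1 c2), M2, out2)"
    "represents M2 H2"
    using big_Seq.IH(2)[of ?i1 M1] big_Seq.prems 1 reach_bounded[OF 1(3)]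
      big_bounded[OF big_Seq.hyps(1)] by (auto simp: Let_def)
  have "t1' + t2' \<le> cost (Seq c1 c2) * (t1 + t2)"
    using 1(2) 2(2) by (simp add: algebra_simps)
  then show ?case using reach_trans[OF 1(3) 2(3)] 1 2
    by (intro exI[of _ "t1' + t2'"] exI[of _ M2]) (auto simp: Let_def add_ac)
next
  case (big_CondT H e c1 out t H1 out1 c2)
  let ?i1 = "i + length (comp_exp 0 e)"
  let ?m = "?i1 + 1 + length (comp_com (?i1 + 1) c2) + 2"
  obtain M1 where M1: "reach P inp (b ^ w) (i, M, out) (length (comp_exp 0 e)) (?i1, M1, out)"
    "represents M1 H" "M1 (temp 0) = ev inp H e"
    using comp_exp_correct[OF big_CondT.prems(1-3), of P i 0 e M w out] big_CondT.prems
    by (auto simp: Let_def)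
  have 1: "reach P inp (b ^ w) (?i1, M1, out) 1 (?m, M1, out)"
    using big_CondT M1 reach_bounded[OF M1(1)] by (intro reach_instr) (auto simp: Let_def)
  obtain t' M2 where 2: "t \<le> t'" "t' \<le> cost c1 * t"
    "reach P inp (b ^ w) (?m, M1, out) t' (?m + length (comp_com ?m c1), M2, out1)"
    "represents M2 H1"
    using big_CondT.IH[of ?m M1] big_CondT.prems M1 reach_bounded[OF 1]
    by (auto simp: Let_def add_ac)
  have "length (comp_exp 0 e) + 1 + t' \<le> cost (Cond e c1 c2) * (t + 1)"
    using 2(2) by (simp add: algebra_simps)
  then show ?case using reach_trans[OF reach_trans[OF M1(1) 1] 2(3)] 2
    by (intro exI[of _ "length (comp_exp 0 e) + 1 + t'"] exI[of _ M2]) (auto simp: Let_def add_ac)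
next
  case (big_CondF H e c2 out t H1 out1 c1)
  let ?i1 = "i + length (comp_exp 0 e)"
  let ?i2 = "?i1 + 1 + length (comp_com (?i1 + 1) c2)"
  let ?m = "?i2 + 2"
  let ?l = "?m + length (comp_com ?m c1)"
  obtain M1 where M1: "reach P inp (b ^ w) (i, M, out) (length (comp_exp 0 e)) (?i1, M1, out)"
    "represents M1 H" "M1 (temp 0) = ev inp H e"
    using comp_exp_correct[OF big_CondF.prems(1-3), of P i 0 e M w out] big_CondF.prems
    by (auto simp: Let_def)
  have 1: "reach P inp (b ^ w) (?i1, M1, out) 1 (?i1 + 1, M1, out)"
    using big_CondF M1 reach_bounded[OF M1(1)] by (intro reach_instr) (auto simp: Let_def)
  obtain t' M2 where 2: "t \<le> t'" "t' \<le> cost c2 * t"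
    "reach P inp (b ^ w) (?i1 + 1, M1, out) t' (?i2, M2, out1)"
    "represents M2 H1"
    using big_CondF.IH[of "?i1 + 1" M1] big_CondF.prems M1 reach_bounded[OF 1]
    by (auto simp: Let_def add_ac)
  have 3: "reach P inp (b ^ w) (?i2, M2, out1) 2 (?l, M2(temp 0 := 1), out1)"
    using big_CondF.prems reach_bounded[OF 2(3)] by (intro reach_jump) (auto simp: Let_def add_ac)
  have "length (comp_exp 0 e) + 1 + t' + 2 \<le> cost (Cond e c1 c2) * (t + 1)"
    using 2(2) by (simp add: algebra_simps)
  then show ?case using reach_trans[OF reach_trans[OF reach_trans[OF M1(1) 1] 2(3)] 3] 2
    by (intro exI[of _ "length (comp_exp 0 e) + 1 + t' + 2"] exI[of _ "M2(temp 0 := 1)"])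
       (auto simp del: fun_upd_apply simp: Let_def add_ac)
next
  case (big_LoopT H e c out t1 H1 out1 t2 H2 out2)
  let ?i1 = "i + length (comp_exp 0 e)"
  let ?i2 = "?i1 + 3 + length (comp_com (?i1 + 3) c)"
  obtain M1 where M1: "reach P inp (b ^ w) (i, M, out) (length (comp_exp 0 e)) (?i1, M1, out)"
    "represents M1 H" "M1 (temp 0) = ev inp H e"
    using comp_exp_correct[OF big_LoopT.prems(1-3), of P i 0 e M w out] big_LoopT.prems
    by (auto simp: Let_def)
  have 1: "reach P inp (b ^ w) (?i1, M1, out) 1 (?i1 + 3, M1, out)"
    using big_LoopT M1 reach_bounded[OF M1(1)] by (intro reach_instr) (auto simp: Let_def)
  obtain t1' M2 where 2: "t1 \<le> t1'" "t1' \<le> cost c * t1"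
    "reach P inp (b ^ w) (?i1 + 3, M1, out) t1' (?i2, M2, out1)"
    "represents M2 H1"
    using big_LoopT.IH(1)[of "?i1 + 3" M1] big_LoopT.prems M1 reach_bounded[OF 1]
    by (auto simp: Let_def add_ac numeral_3_eq_3)
  have 3: "reach P inp (b ^ w) (?i2, M2, out1) 2 (i, M2(temp 0 := 1), out1)"
    using big_LoopT.prems reach_bounded[OF 2(3)]
    by (intro reach_jump) (auto simp: Let_def add_ac numeral_3_eq_3)
  obtain t2' M3 where 4: "t2 \<le> t2'" "t2' \<le> cost (Loop e c) * t2"
    "reach P inp (b ^ w) (i, M2(temp 0 := 1), out1) t2' (i + length (comp_com i (Loop e c)), M3, out2)"
    "represents M3 H2"
    using big_LoopT.IH(2)[of i "M2(temp 0 := 1)"] big_LoopT.prems 2 reach_bounded[OF 3]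
      big_bounded[OF big_LoopT.hyps(2)] by fastforce
  have "length (comp_exp 0 e) + 1 + t1' + 2 + t2' \<le> cost (Loop e c) * (t1 + t2 + 1)"
    using 2(2) 4(2) by (simp add: algebra_simps)
  then show ?case
    using reach_trans[OF reach_trans[OF reach_trans[OF reach_trans[OF M1(1) 1] 2(3)] 3] 4(3)] 2 4
    by (intro exI[of _ "length (comp_exp 0 e) + 1 + t1' + 2 + t2'"] exI[of _ M3]) auto
next
  case (big_LoopF H e c out)
  let ?i1 = "i + length (comp_exp 0 e)"
  let ?l = "i + length (comp_com i (Loop e c))"
  obtain M1 where M1: "reach P inp (b ^ w) (i, M, out) (length (comp_exp 0 e)) (?i1, M1, out)"
    "represents M1 H" "M1 (temp 0) = ev inp H e"
    using comp_exp_correct[OF big_LoopF.prems(1-3), of P i 0 e M w out] big_LoopF.prems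
    by (auto simp: Let_def)
  have 1: "reach P inp (b ^ w) (?i1, M1, out) 1 (?i1 + 1, M1, out)"
    using big_LoopF M1 reach_bounded[OF M1(1)] by (intro reach_instr) (auto simp: Let_def)
  have 2: "reach P inp (b ^ w) (?i1 + 1, M1, out) 2 (?l, M1(temp 0 := 1), out)"
    using big_LoopF.prems reach_bounded[OF 1]
    by (intro reach_jump) (auto simp: Let_def add_ac numeral_3_eq_3)
  show ?case using reach_trans[OF reach_trans[OF M1(1) 1] 2] M1
    by (intro exI[of _ "length (comp_exp 0 e) + 1 + 2"] exI[of _ "M1(temp 0 := 1)"]) (auto simp del: fun_upd_apply)
qed

lemma compiled_program:
  assumes big: "big inp b c (\<lambda>_. 0) [] t H out"
    and b: "2 \<le> b" "\<forall>x\<in>set inp. \<bar>x\<bar> \<le> b"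
  shows "terminates (comp_com 0 c) inp" "result (comp_com 0 c) inp = out"
    and "t \<le> run_time (comp_com 0 c) inp" "run_time (comp_com 0 c) inp \<le> cost c * t"
    and "\<bar>fst (snd (config_after (comp_com 0 c) inp s)) a\<bar> \<le> b ^ (com_weight c + 1)"
proof -
  let ?P = "comp_com 0 c"
  let ?B = "b ^ (com_weight c + 1)"
  have bd: "bounded_by x (\<lambda>_. 0)" if "x \<ge> 0" for x using that by (simp add: bounded_by_def)
  obtain t' M' where t': "t \<le> t'" "t' \<le> cost c * t"
    "reach ?P inp ?B (0, \<lambda>_. 0, []) t' (length ?P, M', out)"
    using comp_com_correct[OF big b, of ?P 0 "\<lambda>_. 0" "com_weight c + 1"] code_at_self b bd
    by (auto simp: represents_def)
  have halt: "halted ?P (config_after ?P inp t')"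
    using t'(3) by (simp add: reach_def config_after_def halted_def)
  have nhalt: "\<not> halted ?P (config_after ?P inp s)" if "s < t'" for s
    using t'(3) that by (simp add: reach_def config_after_def)
  have rt: "run_time ?P inp = t'"
    unfolding run_time_def using halt nhalt by (metis (no_types, lifting) Least_equality linorder_not_less)
  show "terminates ?P inp" using halt by (auto simp: terminates_def)
  show "result ?P inp = out" "t \<le> run_time ?P inp" "run_time ?P inp \<le> cost c * t"
    using t' by (auto simp: rt result_def reach_def config_after_def)
  \<comment> \<open>A halted machine stays where it is, so the bound at all times reduces to times
    up to \<open>t'\<close>.\<close>
  have "config_after ?P inp s = config_after ?P inp (min s t')"
  proof (cases "s \<le> t'")
    case False
    have "config_after ?P inp (r + t') = config_after ?P inp t'" for r
      using halt by (induction r) (auto simp: config_after_def step_def)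
    from this[of "s - t'"] False show ?thesis by (simp add: min_def)
  qed (simp add: min_def)
  then show "\<bar>fst (snd (config_after ?P inp s)) a\<bar> \<le> ?B"
    using t'(3) by (simp add: reach_def config_after_def bounded_by_def)
qed

section \<open>Simulating a gap algorithm on the reduced instance\<close>

abbreviation add_exp (infixl "+\<^sub>e" 65) where "e1 +\<^sub>e e2 \<equiv> Bin APlus e1 e2"
abbreviation sub_exp (infixl "-\<^sub>e" 65) where "e1 -\<^sub>e e2 \<equiv> Bin AMinus e1 e2"
abbreviation mult_exp (infixl "*\<^sub>e" 70) where "e1 *\<^sub>e e2 \<equiv> Bin ATimes e1 e2"

text \<open>The test \<open>x > 0\<close> as arithmetic: since
  \<open>\<bar>x\<bar> < x * x + 1\<close>, rounding \<open>- x / (x * x + 1)\<close> down gives -1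
  for positive \<open>x\<close> and 0 otherwise. With such tests an input word of the reduced
  instance becomes a single expression, hence readable in constant time.\<close>

definition ind :: "exp \<Rightarrow> exp" where
  "ind e = Num 0 -\<^sub>e Bin ADiv (Num 0 -\<^sub>e e) (e *\<^sub>e e +\<^sub>e Num 1)"

text \<open>For integers, one minus the squared difference is positive exactly at equality.\<close>

definition eq_exp :: "exp \<Rightarrow> exp \<Rightarrow> exp" where
  "eq_exp e1 e2 = ind (Num 1 -\<^sub>e (e1 -\<^sub>e e2) *\<^sub>e (e1 -\<^sub>e e2))"

text \<open>Both branches are evaluated. The discarded one may compute nonsense, such as a division
  by 0 or a read outside the input; evaluation is total and the factor 0 removes the result.\<close>

definition ite :: "exp \<Rightarrow> exp \<Rightarrow> exp \<Rightarrow> exp" where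
  "ite e e1 e2 = e *\<^sub>e e1 +\<^sub>e (Num 1 -\<^sub>e e) *\<^sub>e e2"

lemma abs_le_square: "\<bar>x\<bar> \<le> x * (x::int)"
proof (cases "x = 0")
  case False
  then have "1 \<le> \<bar>x\<bar>" by simp
  from mult_left_mono[OF this, of "\<bar>x\<bar>"] show ?thesis by simp
qed simp

lemma ev_ind [simp]: "ev inp H (ind e) = of_bool (ev inp H e > 0)"
proof -
  have "(- x) div (x * x + 1) = - of_bool (x > 0)" for x :: int
  proof (cases "x > 0")
    case True
    have "(- x + (x * x + 1)) div (x * x + 1) = 0"
      by (intro div_pos_pos_trivial; use abs_le_square[of x] True in linarith)
    moreover have "x * x + 1 \<noteq> 0" using abs_le_square[of x] by linarith
    ultimately show ?thesis using True div_add_self2[of "x * x + 1" "- x"] by simp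
  next
    case False
    then show ?thesis using abs_le_square[of x] by (simp add: div_pos_pos_trivial)
  qed
  then show ?thesis by (simp add: ind_def)
qed

lemma square_less_one_iff: "x * x < (1::int) \<longleftrightarrow> x = 0"
proof
  assume "x * x < 1"
  then have "\<bar>x\<bar> < 1" using abs_le_square[of x] by linarith
  then show "x = 0" by simp
qed simp

lemma ev_eq_exp [simp]: "ev inp H (eq_exp e1 e2) = of_bool (ev inp H e1 = ev inp H e2)"
  by (simp add: eq_exp_def square_less_one_iff)

lemma ev_ite: "ev inp H e \<in> {0, 1} \<Longrightarrow>
    ev inp H (ite e e1 e2) = (if ev inp H e = 1 then ev inp H e1 else ev inp H e2)"
  by (auto simp: ite_def)

section \<open>Random access to the encodings\<close>

lemma length_concat_map_upt: "length (concat (map (\<lambda>i. map (f i) [0..<m]) [0..<n])) = n * m"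
  by (induction n) auto

lemma nth_concat_map_upt:
  "i < n \<Longrightarrow> j < m \<Longrightarrow> concat (map (\<lambda>i. map (f i) [0..<m]) [0..<n]) ! (i * m + j) = f i j"
proof (induction n)
  case (Suc n)
  show ?case
  proof (cases "i < n")
    case True
    have "i * m + j < Suc i * m" using Suc by simp
    also have "\<dots> \<le> n * m" using True by (intro mult_right_mono) auto
    finally show ?thesis using Suc True by (simp add: nth_append length_concat_map_upt)
  next
    case False
    then have "i = n" using Suc by simp
    then show ?thesis using Suc by (simp add: nth_append length_concat_map_upt)
  qed
qed simp

lemma length_adjacency_matrix: "length (adjacency_matrix n E) = n * n"
  unfolding adjacency_matrix_def by (rule length_concat_map_upt)

lemma nth_adjacency_matrix:
  "i < n \<Longrightarrow> j < n \<Longrightarrow> adjacency_matrix n E ! (i * n + j) = of_bool ({i, j} \<in> E)"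
  unfolding adjacency_matrix_def by (subst nth_concat_map_upt) auto

lemma lookup_int: "lookup xs (int i) = (if i < length xs then xs ! i else 0)"
  by (simp add: lookup_def)

definition clique_encode :: "nat \<Rightarrow> nat set set \<Rightarrow> nat \<Rightarrow> int list" where
  "clique_encode n E k = [int n, int k] @ adjacency_matrix n E"

lemma lookup_clique_encode:
  "lookup (clique_encode n E k) 0 = int n"
  "lookup (clique_encode n E k) 1 = int k"
  "i < n \<Longrightarrow> j < n \<Longrightarrow> lookup (clique_encode n E k) (2 + int i * int n + int j) = of_bool ({i, j} \<in> E)"
proof -
  show "lookup (clique_encode n E k) 0 = int n" "lookup (clique_encode n E k) 1 = int k"
    by (simp_all add: lookup_def clique_encode_def)
  assume ij: "i < n" "j < n"
  then have "i * n + j < Suc i * n" by simp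
  also have "\<dots> \<le> n * n" using ij by (intro mult_right_mono) auto
  finally have "i * n + j < n * n" .
  then have "lookup (clique_encode n E k) (int (Suc (Suc (i * n + j)))) = of_bool ({i, j} \<in> E)"
    using nth_adjacency_matrix[OF ij, of E]
    unfolding lookup_int clique_encode_def by (simp add: length_adjacency_matrix)
  then show "lookup (clique_encode n E k) (2 + int i * int n + int j) = of_bool ({i, j} \<in> E)"
    by (simp add: add.assoc)
qed

text \<open>The cascade follows the order of tests in \<open>read_exp\<close>, so that the two can
  be compared branch by branch. Positions in the matrix are row-major, whence \<open>div\<close> and
  \<open>mod\<close>.\<close>

lemma lookup_gap_encode:
  "lookup (gap_encode (n, E, S, k, d)) x =
     (if x = 0 then int n else if x = 1 then int k else if x = 2 then int d
      else if 3 \<le> x \<and> x < 3 + int n then of_bool (nat (x - 3) \<in> S)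
      else if 3 + int n \<le> x \<and> x < 3 + int n + int n * int n
        then of_bool ({nat (x - 3 - int n) div n, nat (x - 3 - int n) mod n} \<in> E)
      else 0)"
proof -
  consider "x < 0" | "x = 0" | "x = 1" | "x = 2" | i where "x = 3 + int i" "i < n"
    | y where "x = 3 + int n + int y" "y < n * n" | "x \<ge> 3 + int n + int n * int n"
  proof -
    assume a: "x < 0 \<Longrightarrow> thesis" "x = 0 \<Longrightarrow> thesis" "x = 1 \<Longrightarrow> thesis" "x = 2 \<Longrightarrow> thesis"
      "\<And>i. x = 3 + int i \<Longrightarrow> i < n \<Longrightarrow> thesis" "\<And>y. x = 3 + int n + int y \<Longrightarrow> y < n * n \<Longrightarrow> thesis"
      "x \<ge> 3 + int n + int n * int n \<Longrightarrow> thesis"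
    have "x < 0 \<or> x = 0 \<or> x = 1 \<or> x = 2 \<or> (3 \<le> x \<and> x < 3 + int n) \<or>
        (3 + int n \<le> x \<and> x < 3 + int n + int n * int n) \<or> x \<ge> 3 + int n + int n * int n"
      by linarith
    moreover have thesis if "3 \<le> x" "x < 3 + int n"
      using a(5)[of "nat (x - 3)"] that by simp
    moreover have thesis if "3 + int n \<le> x" "x < 3 + int n + int n * int n"
      using a(6)[of "nat (x - 3 - int n)"] that by (simp add: nat_less_iff)
    ultimately show thesis using a by blast
  qed
  then show ?thesis
  proof cases
    case (5 i)
    then show ?thesis by (simp add: lookup_def gap_encode_def nth_append nat_add_distrib)
  next
    case (6 y)
    then have n: "n > 0" by (cases n) auto
    then have "y div n < n" "y mod n < n" using 6 by (auto simp: less_mult_imp_div_less)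
    from nth_adjacency_matrix[OF this, of E]
    have "adjacency_matrix n E ! y = of_bool ({y div n, y mod n} \<in> E)" by simp
    moreover have "int y < int n * int n" using 6 by (metis of_nat_less_iff of_nat_mult)
    ultimately show ?thesis using 6
      by (simp add: lookup_def gap_encode_def nth_append nat_add_distrib length_adjacency_matrix)
  next
    case 7
    moreover have "0 \<le> int n * int n" by simp
    ultimately have "3 + int n \<le> x" by linarith
    moreover have "\<not> x < int (length (gap_encode (n, E, S, k, d)))"
      using 7 by (simp add: gap_encode_def length_adjacency_matrix)
    ultimately show ?thesis using 7 by (simp add: lookup_def)
  qed (auto simp: lookup_def gap_encode_def)
qed

text \<open>
  \<open>G\<close> contains every vertex that can lie in a clique of the required size. On \<open>G\<close> the graph is
  complemented; the new vertices \<open>n, \<dots>, m - 1\<close> form an independent set completely joined to \<open>G\<close>.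
\<close>

definition reduction_edges :: "nat \<Rightarrow> nat \<Rightarrow> nat set set \<Rightarrow> nat set \<Rightarrow> nat set set" where
  "reduction_edges n m E G =
     {{i, j} | i j. i \<in> G \<and> j \<in> G \<and> i \<noteq> j \<and> {i, j} \<notin> E} \<union> {{i, j} | i j. i \<in> G \<and> n \<le> j \<and> j < m}"

lemma reduction_edges_iff:
  "{i, j} \<in> reduction_edges n m E G \<longleftrightarrow>
     (i \<in> G \<and> j \<in> G \<and> i \<noteq> j \<and> {i, j} \<notin> E) \<or> (i \<in> G \<and> n \<le> j \<and> j < m) \<or> (j \<in> G \<and> n \<le> i \<and> i < m)"
  unfolding reduction_edges_def by (auto simp: doubleton_eq_iff insert_commute)

text \<open>Vertices below \<open>n\<close> outside \<open>G\<close> remain as isolated vertices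
  instead of being deleted, so nothing has to be renumbered.\<close>

definition reduction :: "nat \<Rightarrow> nat set set \<Rightarrow> nat \<Rightarrow> nat \<Rightarrow> nat set \<Rightarrow> gap_instance" where
  "reduction n E k d G =
     (n + (k - d), reduction_edges n (n + (k - d)) E G, G, 2 * k - d, d)"

text \<open>Three disjoint address ranges: even cells hold the simulated memory, positive odd cells
  the table of excluded vertices, negative odd cells these registers. Registers 0 and 7 hold
  \<open>n\<close> and \<open>k\<close>, 2 the simulated program counter, 3 whether an output has
  been written; 4, 5 and 6 serve the degree count.\<close>

definition reg :: "nat \<Rightarrow> int" where
  "reg i = - 2 * int i - 1"

lemma reg_neq [simp]:
  "reg i = reg j \<longleftrightarrow> i = j" "reg i \<noteq> 2 * a" "2 * a \<noteq> reg i"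
  "reg i \<noteq> 2 * int v + 1" "2 * int v + 1 \<noteq> reg i"
  "2 * a \<noteq> 2 * c + (1::int)" "2 * c + 1 \<noteq> 2 * (a::int)"
  unfolding reg_def by presburger+

abbreviation Reg :: "nat \<Rightarrow> exp" where "Reg i \<equiv> Mem (Num (reg i))"

definition order_exp :: "nat \<Rightarrow> exp" where
  "order_exp d = Reg 0 +\<^sub>e (Reg 7 -\<^sub>e Num (int d))"

definition member_exp :: "exp \<Rightarrow> exp" where
  "member_exp x = ind (Reg 0 -\<^sub>e x) *\<^sub>e (Num 1 -\<^sub>e Mem (Num 2 *\<^sub>e x +\<^sub>e Num 1))"

text \<open>The three summands exclude each other because \<open>G\<close> lies below
  \<open>n\<close>, so the sum is again 0 or 1. The condition that a new vertex is below
  \<open>m\<close> needs no test: \<open>div\<close> and \<open>mod\<close> only deliver indices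
  below \<open>m\<close>.\<close>

definition edge_exp :: "exp \<Rightarrow> exp \<Rightarrow> exp" where
  "edge_exp x y =
     member_exp x *\<^sub>e member_exp y *\<^sub>e (Num 1 -\<^sub>e eq_exp x y) *\<^sub>e (Num 1 -\<^sub>e Inp (Num 2 +\<^sub>e x *\<^sub>e Reg 0 +\<^sub>e y))
     +\<^sub>e member_exp x *\<^sub>e ind (y +\<^sub>e Num 1 -\<^sub>e Reg 0) +\<^sub>e ind (x +\<^sub>e Num 1 -\<^sub>e Reg 0) *\<^sub>e member_exp y"

definition read_exp :: "nat \<Rightarrow> exp \<Rightarrow> exp" where
  "read_exp d x =
     ite (eq_exp x (Num 0)) (order_exp d)
    (ite (eq_exp x (Num 1)) (Num 2 *\<^sub>e Reg 7 -\<^sub>e Num (int d))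
    (ite (eq_exp x (Num 2)) (Num (int d))
    (ite (ind (x -\<^sub>e Num 2) *\<^sub>e ind (Num 3 +\<^sub>e order_exp d -\<^sub>e x)) (member_exp (x -\<^sub>e Num 3))
    (ite (ind (x -\<^sub>e Num 2 -\<^sub>e order_exp d) *\<^sub>e ind (Num 3 +\<^sub>e order_exp d +\<^sub>e order_exp d *\<^sub>e order_exp d -\<^sub>e x))
       (edge_exp (Bin ADiv (x -\<^sub>e Num 3 -\<^sub>e order_exp d) (order_exp d))
                 (Bin AMod (x -\<^sub>e Num 3 -\<^sub>e order_exp d) (order_exp d)))
       (Num 0)))))"

text \<open>The table stores non-membership because memory starts as 0: untouched memory already
  represents \<open>G = {..<n}\<close>, so keeping all vertices takes no time.\<close>

definition params_stored :: "nat \<Rightarrow> nat \<Rightarrow> nat set \<Rightarrow> (int \<Rightarrow> int) \<Rightarrow> bool" where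
  "params_stored n k G H \<longleftrightarrow> H (reg 0) = int n \<and> H (reg 7) = int k \<and>
     (\<forall>v<n. H (2 * int v + 1) = of_bool (v \<notin> G))"

lemma ev_order_exp: "params_stored n k G H \<Longrightarrow> d \<le> k \<Longrightarrow> ev inp H (order_exp d) = int (n + (k - d))"
  by (simp add: order_exp_def params_stored_def of_nat_diff)

lemma ev_member_exp:
  assumes "params_stored n k G H" "G \<subseteq> {..<n}" "ev inp H x = int i"
  shows "ev inp H (member_exp x) = of_bool (i \<in> G)"
  using assms by (cases "i < n") (auto simp: member_exp_def params_stored_def)

lemma ev_edge_exp:
  assumes "params_stored n k G H" "G \<subseteq> {..<n}" "ev inp H x = int i" "ev inp H y = int j"
    and "i < m" "j < m" "inp = clique_encode n E k"
  shows "ev inp H (edge_exp x y) = of_bool ({i, j} \<in> reduction_edges n m E G)"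
proof -
  have Reg: "H (reg 0) = int n" using assms by (simp add: params_stored_def)
  have [simp]: "ev inp H (Inp (Num 2 +\<^sub>e x *\<^sub>e Reg 0 +\<^sub>e y)) = of_bool ({i, j} \<in> E)" if "i \<in> G" "j \<in> G"
  proof -
    have "i < n" "j < n" using that assms by auto
    then show ?thesis using assms lookup_clique_encode(3)[of i n j E k] by (simp add: Reg)
  qed
  have "(i \<in> G \<longrightarrow> i < n) \<and> (j \<in> G \<longrightarrow> j < n)" using assms by auto
  then show ?thesis
    using ev_member_exp[OF assms(1-3)] ev_member_exp[OF assms(1,2,4)] assms(3-6)
    unfolding edge_exp_def reduction_edges_iff
    by (cases "i \<in> G"; cases "j \<in> G") (auto simp: Reg simp del: ev.simps(4))
qed

lemma ev_read_exp:
  assumes "params_stored n k G H" "G \<subseteq> {..<n}" "d \<le> k" "inp = clique_encode n E k"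
  shows "ev inp H (read_exp d x) = lookup (gap_encode (reduction n E k d G)) (ev inp H x)"
proof -
  define m where "m = n + (k - d)"
  define z where "z = ev inp H x"
  have N: "ev inp H (order_exp d) = int m" using ev_order_exp[OF assms(1,3)] by (simp add: m_def)
  have K: "H (reg 7) = int k" using assms by (simp add: params_stored_def)
  have K': "int (2 * k - d) = 2 * int k - int d" using assms(3) by linarith
  have mem: "ev inp H (member_exp (x -\<^sub>e Num 3)) = of_bool (nat (z - 3) \<in> G)" if "3 \<le> z"
    using ev_member_exp[OF assms(1,2), of inp "x -\<^sub>e Num 3" "nat (z - 3)"] that by (simp add: z_def)
  have edge: "ev inp H (edge_exp (Bin ADiv (x -\<^sub>e Num 3 -\<^sub>e order_exp d) (order_exp d))
                 (Bin AMod (x -\<^sub>e Num 3 -\<^sub>e order_exp d) (order_exp d))) =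
      of_bool ({nat (z - 3 - int m) div m, nat (z - 3 - int m) mod m} \<in> reduction_edges n m E G)"
    if z: "3 + int m \<le> z" "z < 3 + int m + int m * int m"
  proof -
    obtain y where y: "z = 3 + int m + int y" using z(1) zle_iff_zadd by blast
    then have "int y < int (m * m)" using z(2) by simp
    then have "y < m * m" by (simp only: of_nat_less_iff)
    moreover from this have "m > 0" by (cases m) auto
    ultimately have "y div m < m" "y mod m < m" by (auto simp: less_mult_imp_div_less)
    then show ?thesis
      using y by (subst ev_edge_exp[OF assms(1,2), of inp _ "y div m" _ "y mod m" m E])
        (use N assms z_def in \<open>auto simp: zdiv_int zmod_int\<close>)
  qed
  have "ev inp H (read_exp d x) =
     (if z = 0 then int m else if z = 1 then int (2 * k - d) else if z = 2 then int d
      else if 3 \<le> z \<and> z < 3 + int m then of_bool (nat (z - 3) \<in> G)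
      else if 3 + int m \<le> z \<and> z < 3 + int m + int m * int m
        then of_bool ({nat (z - 3 - int m) div m, nat (z - 3 - int m) mod m} \<in> reduction_edges n m E G)
      else 0)"
    unfolding read_exp_def using mem edge
    by (simp add: ev_ite N K K' z_def[symmetric])
  then show ?thesis by (simp add: reduction_def lookup_gap_encode m_def z_def)
qed

section \<open>Simulating instructions\<close>

abbreviation next_instr :: com where "next_instr \<equiv> Asg (Num (reg 2)) (Reg 2 +\<^sub>e Num 1)"

text \<open>
  Cell \<open>a\<close> of the simulated program is kept in cell \<open>2 * a\<close>. Only the first output is
  written: it is the answer for both versions of the problem.
\<close>

fun sim_instr :: "nat \<Rightarrow> nat \<Rightarrow> instr \<Rightarrow> com" where
  "sim_instr L d (Const x c) = Seq (Asg (Num (2 * x)) (Num c)) next_instr"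
| "sim_instr L d (Op f x y z) = Seq (Bop f (2 * x) (2 * y) (2 * z)) next_instr"
| "sim_instr L d (Load x y) = Seq (Asg (Num (2 * x)) (Mem (Num 2 *\<^sub>e Mem (Num (2 * y))))) next_instr"
| "sim_instr L d (Store x y) =
     Seq (Asg (Num 2 *\<^sub>e Mem (Num (2 * x))) (Mem (Num (2 * y)))) next_instr"
| "sim_instr L d (Read x y) = Seq (Asg (Num (2 * x)) (read_exp d (Mem (Num (2 * y))))) next_instr"
| "sim_instr L d (Write x) =
     Seq (Cond (Reg 3) Skip (Seq (Out (Mem (Num (2 * x)))) (Asg (Num (reg 3)) (Num 1)))) next_instr"
| "sim_instr L d (JumpPos x l) =
     Cond (Mem (Num (2 * x))) (Asg (Num (reg 2)) (Num (int (min l L)))) next_instr"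

text \<open>The current instruction is found by linear search. This costs at most the length of the
  simulated program, a constant.\<close>

fun dispatch :: "nat \<Rightarrow> nat \<Rightarrow> nat \<Rightarrow> instr list \<Rightarrow> com" where
  "dispatch L d i [] = Skip"
| "dispatch L d i (x # xs) = Cond (eq_exp (Reg 2) (Num (int i))) (sim_instr L d x) (dispatch L d (Suc i) xs)"

text \<open>The program counter is capped at \<open>L\<close>: a jump may lead far beyond the
  program, where only the fact of having halted matters, and the capped value is below
  \<open>b\<close> as soon as \<open>L\<close> is.\<close>

definition simulates :: "nat \<Rightarrow> nat \<Rightarrow> nat set \<Rightarrow> nat \<Rightarrow> config \<Rightarrow> (int \<Rightarrow> int) \<Rightarrow> int list \<Rightarrow> bool" where
  "simulates n k G L cf H out \<longleftrightarrow> params_stored n k G H \<and>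
     H (reg 2) = int (min (fst cf) L) \<and> H (reg 3) = of_bool (snd (snd cf) \<noteq> []) \<and>
     (\<forall>a. H (2 * a) = fst (snd cf) a) \<and> out = take 1 (snd (snd cf))"

lemma params_stored_upd [simp]:
  "params_stored n k G (H(2 * a := x)) \<longleftrightarrow> params_stored n k G H"
  "params_stored n k G (H(reg 2 := x)) \<longleftrightarrow> params_stored n k G H"
  "params_stored n k G (H(reg 3 := x)) \<longleftrightarrow> params_stored n k G H"
  by (simp_all add: params_stored_def)

lemma big_Asg_eq:
  "ev inp H e2 = v \<Longrightarrow> \<bar>v\<bar> \<le> b \<Longrightarrow> ev inp H e1 = a \<Longrightarrow> H' = H(a := v) \<Longrightarrow> t = 1 \<Longrightarrow>
   big inp b (Asg e1 e2) H out t H' out"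
  using big_Asg by blast

lemma big_Bop_eq:
  "eval_binop f (H y) (H z) = v \<Longrightarrow> \<bar>v\<bar> \<le> b \<Longrightarrow> H' = H(x := v) \<Longrightarrow> t = 1 \<Longrightarrow>
   big inp b (Bop f x y z) H out t H' out"
  using big_Bop by blast

lemma big_next_instr:
  assumes "H (reg 2) = int pc" "Suc pc \<le> L" "int L \<le> b"
  shows "big inp b next_instr H out 1 (H(reg 2 := int (Suc pc))) out"
  using assms by (intro big_Asg_eq) auto

lemma sim_instr_correct:
  assumes sim: "simulates n k G L (pc, M, out) H out1"
    and G: "G \<subseteq> {..<n}" "d \<le> k" "inp = clique_encode n E k"
    and pc: "pc < L" "int L \<le> b"
    and exec: "exec_instr (gap_encode (reduction n E k d G)) x (pc, M, out) = (pc', M', out')"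
    and M': "bounded_by b M'"
  shows "\<exists>t H' out1'. 1 \<le> t \<and> t \<le> 4 \<and> big inp b (sim_instr L d x) H out1 t H' out1' \<and>
    simulates n k G L (pc', M', out') H' out1'"
proof -
  have params: "params_stored n k G H" and pcr: "H (reg 2) = int pc"
    and flag: "H (reg 3) = of_bool (out \<noteq> [])" and mem: "H (2 * a) = M a" and out1: "out1 = take 1 out"
    for a using sim pc by (auto simp: simulates_def)
  note nxt = big_next_instr[where L = L and b = b, OF _ _ pc(2)]
  \<comment> \<open>Common case of all instructions that write one cell. The bound on the new value
    is read off the assumed bound on the resulting memory \<open>M'\<close>.\<close>
  have assign: ?thesis
    if M'_eq: "M' = M(a := v)" and pc': "pc' = Suc pc" "out' = out"
      and x: "sim_instr L d x = Seq c next_instr"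
      and c: "\<bar>v\<bar> \<le> b \<Longrightarrow> big inp b c H out1 1 (H(2 * a := v)) out1" for a v c
  proof -
    have "\<bar>v\<bar> \<le> b" using M' unfolding M'_eq bounded_by_def by (metis fun_upd_same)
    then have "big inp b (sim_instr L d x) H out1 (1 + 1) (H(2 * a := v, reg 2 := int (Suc pc))) out1"
      unfolding x using pcr pc by (intro big_Seq[OF c nxt]) auto
    moreover have "simulates n k G L (pc', M', out') (H(2 * a := v, reg 2 := int (Suc pc))) out1"
      using sim pc pc' M'_eq by (auto simp: simulates_def)
    ultimately show ?thesis by (intro exI[of _ "1 + 1"]) auto
  qed
  show ?thesis
  proof (cases x)
    case (Const a c)
    then show ?thesis using exec by (intro assign[of a c]) (auto intro!: big_Asg_eq)
  next
    case (Op f a y z)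
    then show ?thesis using exec mem
      by (intro assign[of a "eval_binop f (M y) (M z)"]) (auto intro!: big_Bop_eq)
  next
    case (Load a y)
    then show ?thesis using exec mem by (intro assign[of a "M (M y)"]) (auto intro!: big_Asg_eq)
  next
    case (Store a y)
    then show ?thesis using exec mem by (intro assign[of "M a" "M y"]) (auto intro!: big_Asg_eq)
  next
    case (Read a y)
    let ?v = "lookup (gap_encode (reduction n E k d G)) (M y)"
    have "ev inp H (read_exp d (Mem (Num (2 * y)))) = ?v"
      using ev_read_exp[OF params G, of "Mem (Num (2 * y))"] mem by simp
    then show ?thesis using exec Read
      by (intro assign[of a ?v]) (auto intro!: big_Asg_eq simp: lookup_def)
  next
    case (Write a)
    have ex: "pc' = Suc pc" "M' = M" "out' = out @ [M a]" using exec Write by auto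
    show ?thesis
    proof (cases "out = []")
      case True
      let ?H = "H(reg 3 := 1)"
      have "big inp b (sim_instr L d x) H out1 (1 + 1 + 1 + 1) (?H(reg 2 := int (Suc pc))) [M a]"
        unfolding Write sim_instr.simps
      proof (rule big_Seq)
        show "big inp b next_instr ?H [M a] 1 (?H(reg 2 := int (Suc pc))) [M a]"
          using pcr pc by (intro nxt) auto
        have 1: "big inp b (Out (Mem (Num (2 * a)))) H out1 1 H [M a]"
          using big_Out[of inp b "Mem (Num (2 * a))" H out1] mem out1 True by simp
        have 2: "big inp b (Asg (Num (reg 3)) (Num 1)) H [M a] 1 ?H [M a]"
          using pc by (intro big_Asg_eq) auto
        show "big inp b (Cond (Reg 3) Skip (Seq (Out (Mem (Num (2 * a)))) (Asg (Num (reg 3)) (Num 1))))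
            H out1 (1 + 1 + 1) ?H [M a]"
          using flag True by (intro big_CondF big_Seq[OF 1 2]) auto
      qed
      moreover have "simulates n k G L (pc', M', out') (?H(reg 2 := int (Suc pc))) [M a]"
        using sim pc ex True by (auto simp: simulates_def)
      ultimately show ?thesis by (intro exI[of _ "1 + 1 + 1 + 1"]) auto
    next
      case False
      have "big inp b (sim_instr L d x) H out1 ((0 + 1) + 1) (H(reg 2 := int (Suc pc))) out1"
        unfolding Write sim_instr.simps using flag False pcr pc
        by (intro big_Seq[OF big_CondT[OF _ big_Skip] nxt]) auto
      moreover have "simulates n k G L (pc', M', out') (H(reg 2 := int (Suc pc))) out1"
        using sim pc ex False by (auto simp: simulates_def Suc_le_eq)
      ultimately show ?thesis by (intro exI[of _ "(0 + 1) + 1"]) auto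
    qed
  next
    case (JumpPos a l)
    show ?thesis
    proof (cases "M a > 0")
      case True
      have "big inp b (sim_instr L d x) H out1 (1 + 1) (H(reg 2 := int (min l L))) out1"
        unfolding JumpPos sim_instr.simps using True mem pc
        by (intro big_CondT big_Asg_eq) auto
      moreover have "simulates n k G L (pc', M', out') (H(reg 2 := int (min l L))) out1"
        using sim exec JumpPos True by (auto simp: simulates_def)
      ultimately show ?thesis by (intro exI[of _ "1 + 1"]) auto
    next
      case False
      have "big inp b (sim_instr L d x) H out1 (1 + 1) (H(reg 2 := int (Suc pc))) out1"
        unfolding JumpPos sim_instr.simps using False mem pc pcr
        by (intro big_CondF nxt) auto
      moreover have "simulates n k G L (pc', M', out') (H(reg 2 := int (Suc pc))) out1"
        using sim exec JumpPos False pc by (auto simp: simulates_def)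
      ultimately show ?thesis by (intro exI[of _ "1 + 1"]) auto
    qed
  qed
qed

lemma dispatch_correct:
  assumes "j < length xs" "H (reg 2) = int (i + j)" "big inp b (sim_instr L d (xs ! j)) H out t H' out'"
  shows "big inp b (dispatch L d i xs) H out (t + j + 1) H' out'"
  using assms
proof (induction xs arbitrary: i j)
  case (Cons x xs)
  show ?case
  proof (cases j)
    case 0
    then show ?thesis using Cons.prems by (auto intro!: big_CondT[where t = t, simplified])
  next
    case (Suc j')
    then have "big inp b (dispatch L d (Suc i) xs) H out (t + j' + 1) H' out'"
      using Cons.prems by (intro Cons.IH) auto
    then have "big inp b (dispatch L d i (x # xs)) H out (t + j' + 1 + 1) H' out'"
      unfolding dispatch.simps using Cons.prems Suc by (intro big_CondF) auto
    then show ?thesis using Suc by simp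
  qed
qed simp

definition sim_loop :: "instr list \<Rightarrow> nat \<Rightarrow> com" where
  "sim_loop p d = Loop (Num (int (length p)) -\<^sub>e Reg 2) (dispatch (length p) d 0 p)"

text \<open>\<open>r\<close> counts the steps still to be simulated. Each takes at most 4 for the
  instruction, \<open>length p - 1\<close> failed and one successful comparison, and one loop test,
  which gives \<open>length p + 5\<close>; the final 1 is the failing loop test.\<close>

lemma sim_loop_correct:
  fixes n E k d G
  defines "inp \<equiv> clique_encode n E k" and "g \<equiv> gap_encode (reduction n E k d G)"
  assumes G: "G \<subseteq> {..<n}" "d \<le> k"
    and L: "int (length p) \<le> b"
    and bd: "\<And>s. bounded_by b (fst (snd (config_after p g s)))"
    and T: "\<And>s. s < T \<Longrightarrow> \<not> halted p (config_after p g s)" "halted p (config_after p g T)"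
  shows "s + r = T \<Longrightarrow> simulates n k G (length p) (config_after p g s) H out \<Longrightarrow>
    \<exists>t H' out'. r \<le> t \<and> t \<le> (length p + 5) * r + 1 \<and> big inp b (sim_loop p d) H out t H' out' \<and>
      simulates n k G (length p) (config_after p g T) H' out'"
proof (induction r arbitrary: s H out)
  case 0
  then have "H (reg 2) = int (length p)"
    using T(2) by (auto simp: simulates_def halted_def)
  then have "big inp b (sim_loop p d) H out 1 H out"
    unfolding sim_loop_def by (intro big_LoopF) auto
  then show ?case using 0 by (intro exI[of _ 1]) auto
next
  case (Suc r)
  obtain pc M o1 where cf: "config_after p g s = (pc, M, o1)" using prod_cases3 by blast
  obtain pc' M' o1' where cf': "config_after p g (Suc s) = (pc', M', o1')" using prod_cases3 by blast
  have pc: "pc < length p" using T(1)[of s] Suc.prems cf by (simp add: halted_def)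
  have "config_after p g (Suc s) = step p g (config_after p g s)"
    by (simp add: config_after_def)
  then have ex: "exec_instr g (p ! pc) (pc, M, o1) = (pc', M', o1')"
    using cf cf' pc by (simp add: step_def halted_def)
  have "bounded_by b M'" using bd[of "Suc s"] cf' by simp
  then obtain t H1 out1 where t: "1 \<le> t" "t \<le> 4"
    "big inp b (sim_instr (length p) d (p ! pc)) H out t H1 out1"
    "simulates n k G (length p) (pc', M', o1') H1 out1"
    using sim_instr_correct[OF _ G _ pc L ex[unfolded g_def]] Suc.prems(2) cf inp_def by metis
  have "H (reg 2) = int (0 + pc)" using Suc.prems(2) cf pc by (simp add: simulates_def)
  then have d: "big inp b (dispatch (length p) d 0 p) H out (t + pc + 1) H1 out1"
    using dispatch_correct[OF pc _ t(3)] by blast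
  obtain t2 H2 out2 where t2: "r \<le> t2" "t2 \<le> (length p + 5) * r + 1"
    "big inp b (sim_loop p d) H1 out1 t2 H2 out2"
    "simulates n k G (length p) (config_after p g T) H2 out2"
    using Suc.IH[of "Suc s" H1 out1] Suc.prems t(4) cf' by auto
  have "big inp b (sim_loop p d) H out (t + pc + 1 + t2 + 1) H2 out2"
    unfolding sim_loop_def using d t2(3) \<open>H (reg 2) = _\<close> pc
    by (intro big_LoopT[OF _ d]) (auto simp: sim_loop_def)
  moreover have "t + pc + 1 + t2 + 1 \<le> (length p + 5) * Suc r + 1"
    using t pc t2 by (simp add: algebra_simps)
  ultimately show ?case using t2 by (intro exI[of _ "t + pc + 1 + t2 + 1"]) auto
qed

section \<open>The table of low-degree vertices\<close>

definition count_loop :: com where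
  "count_loop = Loop (Reg 0 -\<^sub>e Reg 5)
     (Seq (Asg (Num (reg 6)) (Reg 6 +\<^sub>e Inp (Num 2 +\<^sub>e Reg 4 *\<^sub>e Reg 0 +\<^sub>e Reg 5)))
          (Asg (Num (reg 5)) (Reg 5 +\<^sub>e Num 1)))"

definition table_loop :: com where
  "table_loop = Loop (Reg 0 -\<^sub>e Reg 4)
     (Seq (Asg (Num (reg 5)) (Num 0))
     (Seq (Asg (Num (reg 6)) (Num 0))
     (Seq count_loop
     (Seq (Asg (Num 2 *\<^sub>e Reg 4 +\<^sub>e Num 1) (ind (Reg 7 -\<^sub>e Num 1 -\<^sub>e Reg 6)))
          (Asg (Num (reg 4)) (Reg 4 +\<^sub>e Num 1))))))"

text \<open>A vertex of a clique of size \<open>k\<close> has \<open>k - 1\<close> neighbours in it;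
  adding 1 on the other side avoids truncated subtraction.\<close>

definition high_degree :: "nat \<Rightarrow> nat set set \<Rightarrow> nat \<Rightarrow> nat set" where
  "high_degree n E k = {v. v < n \<and> k \<le> card {u. u < n \<and> {v, u} \<in> E} + 1}"

text \<open>Each round takes two assignments and one test; the last 1 is the failing test.\<close>

lemma count_loop_correct:
  assumes inp: "inp = clique_encode n E k" and v: "v < n" and b: "int n \<le> b"
    and "u + r = n" "H (reg 0) = int n" "H (reg 4) = int v" "H (reg 5) = int u"
    "H (reg 6) = (\<Sum>w<u. of_bool ({v, w} \<in> E))"
  shows "big inp b count_loop H out (3 * r + 1)
    (H(reg 6 := (\<Sum>w<n. of_bool ({v, w} \<in> E)), reg 5 := int n)) out"
  using assms(4-)
proof (induction r arbitrary: u H)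
  case 0
  then have eq: "H(reg 6 := (\<Sum>w<n. of_bool ({v, w} \<in> E)), reg 5 := int n) = H" by auto
  have "big inp b count_loop H out 1 H out"
    using 0 unfolding count_loop_def by (intro big_LoopF) auto
  then show ?case by (simp only: eq mult_0_right add_0)
next
  case (Suc r)
  let ?c = "(\<Sum>w<Suc u. of_bool ({v, w} \<in> E)) :: int"
  let ?H = "H(reg 6 := ?c, reg 5 := int (Suc u))"
  have "?c \<le> (\<Sum>w<Suc u. 1)" by (intro sum_mono) auto
  then have c: "\<bar>?c\<bar> \<le> b" using Suc.prems b by (simp add: sum_nonneg)
  have "big inp b (Asg (Num (reg 6)) (Reg 6 +\<^sub>e Inp (Num 2 +\<^sub>e Reg 4 *\<^sub>e Reg 0 +\<^sub>e Reg 5)))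
      H out 1 (H(reg 6 := ?c)) out"
    using Suc.prems v lookup_clique_encode(3)[of v n u E k] c
    by (intro big_Asg_eq) (auto simp: inp simp del: sum_of_bool_eq)
  moreover have "big inp b (Asg (Num (reg 5)) (Reg 5 +\<^sub>e Num 1)) (H(reg 6 := ?c)) out 1 ?H out"
    using Suc.prems b by (intro big_Asg_eq) auto
  ultimately have 1: "big inp b (Seq (Asg (Num (reg 6)) (Reg 6 +\<^sub>e Inp (Num 2 +\<^sub>e Reg 4 *\<^sub>e Reg 0 +\<^sub>e Reg 5)))
          (Asg (Num (reg 5)) (Reg 5 +\<^sub>e Num 1))) H out (1 + 1) ?H out"
    by (rule big_Seq)
  have "big inp b count_loop ?H out (3 * r + 1)
     (?H(reg 6 := (\<Sum>w<n. of_bool ({v, w} \<in> E)), reg 5 := int n)) out"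
    using Suc.prems by (intro Suc.IH) (auto simp del: sum_of_bool_eq)
  then have "big inp b count_loop H out (1 + 1 + (3 * r + 1) + 1)
     (?H(reg 6 := (\<Sum>w<n. of_bool ({v, w} \<in> E)), reg 5 := int n)) out"
    unfolding count_loop_def using Suc.prems by (intro big_LoopT[OF _ 1]) auto
  moreover have "?H(reg 6 := (\<Sum>w<n. of_bool ({v, w} \<in> E)), reg 5 := int n) =
      H(reg 6 := (\<Sum>w<n. of_bool ({v, w} \<in> E)), reg 5 := int n)" by auto
  moreover have "1 + 1 + (3 * r + 1) + 1 = 3 * Suc r + 1" by simp
  ultimately show ?case by metis
qed

text \<open>A round takes \<open>3 * n + 1\<close> for the inner loop, four assignments and one
  test. Simulated memory and the registers 2 and 3 are untouched, so the simulation can start right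
  afterwards.\<close>

lemma table_loop_correct:
  assumes inp: "inp = clique_encode n E k" and b: "int n \<le> b" "1 \<le> b"
    and "v + r = n" "H (reg 0) = int n" "H (reg 7) = int k" "H (reg 4) = int v"
    "\<forall>w<v. H (2 * int w + 1) = of_bool (w \<notin> high_degree n E k)"
  shows "\<exists>H'. big inp b table_loop H out ((3 * n + 6) * r + 1) H' out \<and>
     params_stored n k (high_degree n E k) H' \<and> H' (reg 2) = H (reg 2) \<and> H' (reg 3) = H (reg 3) \<and>
     (\<forall>a. H' (2 * a) = H (2 * a))"
  using assms(4-)
proof (induction r arbitrary: v H)
  case 0
  have "big inp b table_loop H out 1 H out"
    unfolding table_loop_def using 0 by (intro big_LoopF) auto
  then show ?case using 0 by (intro exI[of _ H]) (auto simp: params_stored_def)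
next
  case (Suc r)
  let ?c = "(\<Sum>w<n. of_bool ({v, w} \<in> E)) :: int"
  let ?t = "of_bool (int k - 1 - ?c > 0) :: int"
  let ?H1 = "H(reg 5 := 0, reg 6 := 0)"
  let ?H2 = "?H1(reg 6 := ?c, reg 5 := int n)"
  let ?H3 = "?H2(2 * int v + 1 := ?t)"
  let ?H4 = "?H3(reg 4 := int (Suc v))"
  have v: "v < n" using Suc.prems by simp
  have c: "?c = int (card {u. u < n \<and> {v, u} \<in> E})"
  proof -
    have "{..<n} \<inter> {w. {v, w} \<in> E} = {u. u < n \<and> {v, u} \<in> E}" by auto
    then show ?thesis by simp
  qed
  have 1: "big inp b (Asg (Num (reg 5)) (Num 0)) H out 1 (H(reg 5 := 0)) out"
    "big inp b (Asg (Num (reg 6)) (Num 0)) (H(reg 5 := 0)) out 1 ?H1 out"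
    using b by (auto intro!: big_Asg_eq)
  have 2: "big inp b count_loop ?H1 out (3 * n + 1) ?H2 out"
    using Suc.prems by (intro count_loop_correct[OF inp v b(1), of 0]) auto
  have 3: "big inp b (Asg (Num 2 *\<^sub>e Reg 4 +\<^sub>e Num 1) (ind (Reg 7 -\<^sub>e Num 1 -\<^sub>e Reg 6))) ?H2 out 1 ?H3 out"
    using Suc.prems b by (intro big_Asg_eq) auto
  have 4: "big inp b (Asg (Num (reg 4)) (Reg 4 +\<^sub>e Num 1)) ?H3 out 1 ?H4 out"
    using Suc.prems b by (intro big_Asg_eq) auto
  note body = big_Seq[OF 1(1) big_Seq[OF 1(2) big_Seq[OF 2 big_Seq[OF 3 4]]]]
  define H4 where "H4 = ?H4"
  have H4: "H4 (reg 0) = int n" "H4 (reg 7) = int k" "H4 (reg 4) = int (Suc v)"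
    "H4 (reg 2) = H (reg 2)" "H4 (reg 3) = H (reg 3)" "\<forall>a. H4 (2 * a) = H (2 * a)"
    using Suc.prems by (simp_all add: H4_def)
  have tab: "\<forall>w<Suc v. H4 (2 * int w + 1) = of_bool (w \<notin> high_degree n E k)"
    using Suc.prems c v by (auto simp: less_Suc_eq high_degree_def H4_def)
  have "Suc v + r = n" using Suc.prems by simp
  from Suc.IH[OF this H4(1-3) tab]
  obtain H' where H': "big inp b table_loop H4 out ((3 * n + 6) * r + 1) H' out"
     "params_stored n k (high_degree n E k) H'" "H' (reg 2) = H (reg 2)" "H' (reg 3) = H (reg 3)"
     "\<forall>a. H' (2 * a) = H (2 * a)"
    unfolding H4(4,5) using H4(6) by auto
  have "big inp b table_loop H out (1 + (1 + (3 * n + 1 + (1 + 1))) + ((3 * n + 6) * r + 1) + 1) H' out"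
    unfolding table_loop_def using Suc.prems H'(1)[unfolded H4_def]
    by (intro big_LoopT[OF _ body]) (simp_all only: table_loop_def, simp)
  moreover have "1 + (1 + (3 * n + 1 + (1 + 1))) + ((3 * n + 6) * r + 1) + 1 = (3 * n + 6) * Suc r + 1"
    by simp
  ultimately have "big inp b table_loop H out ((3 * n + 6) * Suc r + 1) H' out" by metis
  then show ?case using H' by blast
qed

text \<open>
  The table of low-degree vertices costs quadratic time; it is computed only if
  \<open>\<alpha> - \<beta> * k \<le> 0\<close>, and otherwise all vertices are kept.
\<close>

definition clique_com :: "instr list \<Rightarrow> nat \<Rightarrow> int \<Rightarrow> int \<Rightarrow> com" where
  "clique_com p d \<alpha> \<beta> =
     Seq (Asg (Num (reg 0)) (Inp (Num 0)))
    (Seq (Asg (Num (reg 7)) (Inp (Num 1)))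
    (Cond (Reg 7 -\<^sub>e Reg 0) (Out (Num 0))
      (Seq (Cond (Num \<alpha> -\<^sub>e Num \<beta> *\<^sub>e Reg 7) Skip table_loop) (sim_loop p d))))"

definition kept :: "int \<Rightarrow> int \<Rightarrow> nat \<Rightarrow> nat set set \<Rightarrow> nat \<Rightarrow> nat set" where
  "kept \<alpha> \<beta> n E k = (if \<alpha> - \<beta> * int k > 0 then {..<n} else high_degree n E k)"

lemma kept_subset: "kept \<alpha> \<beta> n E k \<subseteq> {..<n}"
  by (auto simp: kept_def high_degree_def)

lemma clique_com_start:
  fixes n E k
  defines "inp \<equiv> clique_encode n E k"
  assumes b: "int n \<le> b" "int k \<le> b"
    and c: "big inp b (Cond (Reg 7 -\<^sub>e Reg 0) (Out (Num 0))
      (Seq (Cond (Num \<alpha> -\<^sub>e Num \<beta> *\<^sub>e Reg 7) Skip table_loop) (sim_loop p d)))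
      ((\<lambda>_. 0)(reg 0 := int n, reg 7 := int k)) [] t H out"
  shows "big inp b (clique_com p d \<alpha> \<beta>) (\<lambda>_. 0) [] (1 + (1 + t)) H out"
proof -
  have "big inp b (Asg (Num (reg 0)) (Inp (Num 0))) (\<lambda>_. 0) [] 1 ((\<lambda>_. 0)(reg 0 := int n)) []"
    using b by (intro big_Asg_eq) (auto simp: inp_def lookup_clique_encode)
  moreover have "big inp b (Asg (Num (reg 7)) (Inp (Num 1))) ((\<lambda>_. 0)(reg 0 := int n)) [] 1
      ((\<lambda>_. 0)(reg 0 := int n, reg 7 := int k)) []"
    using b by (intro big_Asg_eq) (auto simp: inp_def lookup_clique_encode)
  ultimately show ?thesis using c unfolding clique_com_def by (intro big_Seq)
qed

text \<open>No clique exceeds \<open>n\<close> vertices, so 0 is the right answer. Treating this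
  case separately leaves \<open>k \<le> n\<close> for the simulation, which keeps the number of new
  vertices, and with it the size of the reduced instance, under control.\<close>

lemma clique_com_large:
  assumes "int n \<le> b" "int k \<le> b" "n < k"
  shows "\<exists>H. big (clique_encode n E k) b (clique_com p d \<alpha> \<beta>) (\<lambda>_. 0) [] 4 H [0]"
proof -
  let ?H = "(\<lambda>_. 0)(reg 0 := int n, reg 7 := int k)"
  have "big (clique_encode n E k) b (Cond (Reg 7 -\<^sub>e Reg 0) (Out (Num 0))
      (Seq (Cond (Num \<alpha> -\<^sub>e Num \<beta> *\<^sub>e Reg 7) Skip table_loop) (sim_loop p d))) ?H [] (1 + 1) ?H [0]"
    using assms big_Out[of _ _ "Num 0" ?H "[]"] by (intro big_CondT) auto
  from clique_com_start[OF assms(1,2) this] show ?thesis by (auto simp: numeral_eq_Suc)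
qed

text \<open>The 6 collects the two reads, the two conditional tests and the failing tests that end
  the table loop and the simulation loop.\<close>

lemma clique_com_correct:
  fixes n E k d \<alpha> \<beta> p
  defines "g \<equiv> gap_encode (reduction n E k d (kept \<alpha> \<beta> n E k))"
  assumes b: "int n \<le> b" "1 \<le> b" "int (length p) \<le> b"
    and k: "k \<le> n" "d \<le> k"
    and p: "terminates p g" "\<And>s. bounded_by b (fst (snd (config_after p g s)))"
  shows "\<exists>t H. big (clique_encode n E k) b (clique_com p d \<alpha> \<beta>) (\<lambda>_. 0) [] t H (take 1 (result p g)) \<and>
    run_time p g \<le> t \<and>
    t \<le> (if \<alpha> - \<beta> * int k > 0 then 0 else (3 * n + 6) * n) + (length p + 5) * run_time p g + 6"
proof -
  let ?inp = "clique_encode n E k"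
  let ?G = "kept \<alpha> \<beta> n E k"
  define T where "T = run_time p g"
  let ?H = "(\<lambda>_. 0)(reg 0 := int n, reg 7 := int k)"
  have not_halted: "\<not> halted p (config_after p g s)" if "s < T" for s
    using that not_less_Least unfolding T_def run_time_def by blast
  have halted: "halted p (config_after p g T)"
    using p(1) LeastI_ex unfolding terminates_def T_def run_time_def by metis
  have "\<exists>t H'. big ?inp b (Cond (Num \<alpha> -\<^sub>e Num \<beta> *\<^sub>e Reg 7) Skip table_loop) ?H [] t H' [] \<and>
      t \<le> (if \<alpha> - \<beta> * int k > 0 then 0 else (3 * n + 6) * n) + 2 \<and>
      simulates n k ?G (length p) (config_after p g 0) H' []"
  proof (cases "\<alpha> - \<beta> * int k > 0")
    case True
    have "big ?inp b (Cond (Num \<alpha> -\<^sub>e Num \<beta> *\<^sub>e Reg 7) Skip table_loop) ?H [] (0 + 1) ?H []"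
      using True by (intro big_CondT[OF _ big_Skip]) auto
    moreover have "simulates n k ?G (length p) (config_after p g 0) ?H []"
      using True by (auto simp: simulates_def params_stored_def config_after_def kept_def)
    ultimately show ?thesis using True by (intro exI[of _ "0 + 1"] exI[of _ ?H]) auto
  next
    case False
    obtain H' where H': "big ?inp b table_loop ?H [] ((3 * n + 6) * n + 1) H' []"
      "params_stored n k (high_degree n E k) H'" "H' (reg 2) = ?H (reg 2)" "H' (reg 3) = ?H (reg 3)"
      "\<forall>a. H' (2 * a) = ?H (2 * a)"
      using table_loop_correct[OF refl b(1,2), where v = 0 and r = n and H = ?H and E = E and k = k
          and out = "[]"] by auto
    have "big ?inp b (Cond (Num \<alpha> -\<^sub>e Num \<beta> *\<^sub>e Reg 7) Skip table_loop) ?H []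
        ((3 * n + 6) * n + 1 + 1) H' []"
      using False H'(1) by (intro big_CondF) auto
    moreover have "simulates n k ?G (length p) (config_after p g 0) H' []"
      using False H' by (auto simp: simulates_def config_after_def kept_def)
    ultimately show ?thesis using False
      by (intro exI[of _ "(3 * n + 6) * n + 1 + 1"] exI[of _ H']) auto
  qed
  then obtain t1 H1 where t1: "big ?inp b (Cond (Num \<alpha> -\<^sub>e Num \<beta> *\<^sub>e Reg 7) Skip table_loop) ?H [] t1 H1 []"
    "t1 \<le> (if \<alpha> - \<beta> * int k > 0 then 0 else (3 * n + 6) * n) + 2"
    "simulates n k ?G (length p) (config_after p g 0) H1 []" by blast
  obtain t2 H2 out2 where t2: "T \<le> t2" "t2 \<le> (length p + 5) * T + 1"
    "big ?inp b (sim_loop p d) H1 [] t2 H2 out2"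
    "simulates n k ?G (length p) (config_after p g T) H2 out2"
    using sim_loop_correct[where s = 0 and r = T and T = T and p = p and b = b and n = n and E = E and k = k and d = d and G = ?G,
        OF kept_subset k(2) b(3) p(2)[unfolded g_def] not_halted[unfolded g_def]
          halted[unfolded g_def] add_0 t1(3)[unfolded g_def]]
    unfolding g_def by blast
  have out2: "out2 = take 1 (result p g)"
    using t2(4) by (simp add: simulates_def result_def T_def)
  have "big ?inp b (Cond (Reg 7 -\<^sub>e Reg 0) (Out (Num 0))
      (Seq (Cond (Num \<alpha> -\<^sub>e Num \<beta> *\<^sub>e Reg 7) Skip table_loop) (sim_loop p d))) ?H [] (t1 + t2 + 1) H2 out2"
    using k by (intro big_CondF big_Seq[OF t1(1) t2(3)]) auto
  from clique_com_start[OF b(1) _ this] k b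
  have "big ?inp b (clique_com p d \<alpha> \<beta>) (\<lambda>_. 0) [] (1 + (1 + (t1 + t2 + 1))) H2 out2" by simp
  then show ?thesis using t1(2) t2(1,2) unfolding out2 T_def
    by (intro exI[of _ "1 + (1 + (t1 + t2 + 1))"] exI[of _ H2]) auto
qed

section \<open>Correctness of the reduction and its parameters\<close>

lemma vertex_cover_kept: "G \<subseteq> {..<m} \<Longrightarrow> vertex_cover {..<m} (reduction_edges n m E G) G"
  by (auto simp: vertex_cover_def reduction_edges_def)

lemma simple_graph_reduction:
  assumes "G \<subseteq> {..<n}" "n \<le> m"
  shows "simple_graph {..<m} (reduction_edges n m E G)"
proof -
  have "e \<subseteq> {..<m} \<and> card e = 2" if e: "e \<in> reduction_edges n m E G" for e
  proof -
    obtain i j where ij: "e = {i, j}" "i \<in> G" "j < m" "i \<noteq> j"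
      using e assms unfolding reduction_edges_def by force
    then show ?thesis using assms by auto
  qed
  then show ?thesis by (simp add: simple_graph_def)
qed

lemma reduction_in_gap_instances:
  assumes "G \<subseteq> {..<n}" "1 \<le> d" "d \<le> k" "(2 * k - d, d) \<in> Q"
  shows "reduction n E k d G \<in> gap_instances Q"
proof -
  have "G \<subseteq> {..<n + (k - d)}" using assms(1) by auto
  then have "vertex_cover {..<n + (k - d)} (reduction_edges n (n + (k - d)) E G) G"
    by (rule vertex_cover_kept)
  moreover have "simple_graph {..<n + (k - d)} (reduction_edges n (n + (k - d)) E G)"
    using assms(1) by (rule simple_graph_reduction) simp
  ultimately show ?thesis using assms(2-4) by (simp add: gap_instances_def reduction_def)
qed

text \<open>Exchange \<open>C\<close> for all new vertices. An edge inside \<open>G\<close> joins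
  two vertices not adjacent in \<open>E\<close>, so \<open>C\<close> cannot contain both ends; an
  edge to a new vertex is covered by that vertex. The gain is
  \<open>k - (k - d) = d\<close>.\<close>

lemma clique_imp_improving_swap:
  assumes "is_clique {..<n} E C" "card C = k" "C \<subseteq> G" "G \<subseteq> {..<n}" "d \<le> k"
  shows "has_improving_swap {..<n + (k - d)} (reduction_edges n (n + (k - d)) E G) G (2 * k - d) d"
proof -
  let ?m = "n + (k - d)"
  let ?X = "{n..<?m}"
  let ?W = "C \<union> ?X"
  have fin: "finite C" using assms finite_subset[of C "{..<n}"] by auto
  have disj: "C \<inter> ?X = {}" "G \<inter> ?X = {}" using assms by auto
  have "card ?W = k + (k - d)" using assms disj(1) fin by (subst card_Un_disjoint) auto
  then have "k_swap {..<?m} (2 * k - d) ?W" using assms by (auto simp: k_swap_def)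
  moreover have "valid_swap {..<?m} (reduction_edges n ?m E G) G ?W"
    unfolding valid_swap_def vertex_cover_def
  proof (intro conjI ballI)
    show "sym_diff G ?W \<subseteq> {..<?m}" using assms by auto
    fix e assume "e \<in> reduction_edges n ?m E G"
    then consider i j where "e = {i, j}" "i \<in> G" "j \<in> G" "i \<noteq> j" "{i, j} \<notin> E"
      | i j where "e = {i, j}" "i \<in> G" "j \<in> ?X"
      unfolding reduction_edges_def by auto
    then show "e \<inter> sym_diff G ?W \<noteq> {}"
    proof cases
      case (1 i j)
      then have "i \<notin> C \<or> j \<notin> C" using assms(1) unfolding is_clique_def by blast
      moreover have "i \<notin> ?X" "j \<notin> ?X" using 1 disj by auto
      ultimately show ?thesis using 1 by auto
    next
      case (2 i j)
      then have "j \<notin> G" using disj by auto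
      then show ?thesis using 2 by auto
    qed
  qed
  moreover have "?W \<inter> G = C" "?W - G = ?X" using assms disj by auto
  then have "improving_swap d G ?W" using assms by (simp add: improving_swap_def)
  ultimately show ?thesis unfolding has_improving_swap_def by blast
qed

lemma smaller_cover_imp_clique:
  assumes cover: "vertex_cover {..<n + (k - d)} (reduction_edges n (n + (k - d)) E G) Y"
    and size: "int (card G) - int (card Y) \<ge> int d"
    and G: "G \<subseteq> {..<n}" and d: "1 \<le> d" "d \<le> k"
  shows "\<exists>C. is_clique {..<n} E C \<and> card C = k"
proof -
  let ?m = "n + (k - d)"
  let ?X = "{n..<?m}"
  have fin: "finite G" "finite Y" using G cover finite_subset unfolding vertex_cover_def by blast+
  have edge: "i \<in> Y \<or> j \<in> Y" if "{i, j} \<in> reduction_edges n ?m E G" for i j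
    using cover that unfolding vertex_cover_def by force
  have X: "?X \<subseteq> Y"
  proof (rule ccontr)
    assume "\<not> ?X \<subseteq> Y"
    then obtain x where "x \<in> ?X" "x \<notin> Y" by blast
    \<comment> \<open>A new vertex is adjacent to all of \<open>G\<close>, so omitting one forces
      all of \<open>G\<close> into \<open>Y\<close>; then \<open>Y\<close> is no smaller than
      \<open>G\<close>, against a gain of at least 1.\<close>
    then have "G \<subseteq> Y" using edge[of _ x] reduction_edges_iff[of _ x n ?m E G] by auto
    then have "card G \<le> card Y" using fin by (intro card_mono)
    then show False using size d by simp
  qed
  have clique: "is_clique {..<n} E (G - Y)"
    using G edge reduction_edges_iff[of _ _ n ?m E G] unfolding is_clique_def by blast
  have "(Y \<inter> G) \<inter> ?X = {}" using G by auto
  then have "card (Y \<inter> G) + card ?X = card ((Y \<inter> G) \<union> ?X)" using fin by (subst card_Un_disjoint) auto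
  also have "\<dots> \<le> card Y" using X fin by (intro card_mono) auto
  finally have "card (Y \<inter> G) + (k - d) \<le> card Y" by simp
  moreover have "card (G - Y) = card G - card (Y \<inter> G)" "card (Y \<inter> G) \<le> card G"
    using fin by (auto simp: card_Diff_subset_Int Int_commute intro: card_mono)
  ultimately have "k \<le> card (G - Y)" using size d by linarith
  \<comment> \<open>\<open>G - Y\<close> may have more than \<open>k\<close> vertices; every subset
    of a clique is a clique.\<close>
  then obtain C where "C \<subseteq> G - Y" "card C = k" using obtain_subset_with_card_n by metis
  then have "is_clique {..<n} E C" using clique by (auto simp: is_clique_def)
  then show ?thesis using \<open>card C = k\<close> by blast
qed

text \<open>Gives the answer 1 of the decision version the meaning it has in the permissive one, so
  that a single argument serves both.\<close>

lemma improving_swap_imp_smaller_cover: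
  assumes "has_improving_swap V E S k d" "finite V" "S \<subseteq> V"
  shows "\<exists>Y. vertex_cover V E Y \<and> int (card S) - int (card Y) \<ge> int d"
proof -
  obtain W where W: "W \<subseteq> V" "vertex_cover V E (sym_diff S W)" "improving_swap d S W"
    using assms(1) unfolding has_improving_swap_def k_swap_def valid_swap_def by blast
  have fin: "finite S" "finite W" using assms W finite_subset by blast+
  have "card (sym_diff S W) = card (S - W) + card (W - S)"
    using fin by (intro card_Un_disjoint) auto
  moreover have "card S = card (S - W) + card (W \<inter> S)"
    using fin by (subst card_Un_disjoint[symmetric]) (auto intro: arg_cong[where f = card])
  ultimately show ?thesis using W unfolding improving_swap_def by (intro exI[of _ "sym_diff S W"]) auto
qed

lemma clique_subset_kept:
  assumes "is_clique {..<n} E C" "card C = k"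
  shows "C \<subseteq> kept \<alpha> \<beta> n E k"
proof -
  have C: "C \<subseteq> {..<n}" using assms(1) by (simp add: is_clique_def)
  then have fin: "finite C" by (rule finite_subset) simp
  have "v \<in> high_degree n E k" if v: "v \<in> C" for v
  proof -
    have "C - {v} \<subseteq> {u. u < n \<and> {v, u} \<in> E}"
    proof
      fix u assume "u \<in> C - {v}"
      then show "u \<in> {u. u < n \<and> {v, u} \<in> E}" using assms(1) v C by (auto simp: is_clique_def)
    qed
    then have "card (C - {v}) \<le> card {u. u < n \<and> {v, u} \<in> E}" by (intro card_mono) auto
    moreover have "card (C - {v}) + 1 = k" using v fin assms(2) card_Suc_Diff1[of C v] by simp
    ultimately show ?thesis using v C by (auto simp: high_degree_def)
  qed
  then show ?thesis using C by (auto simp: kept_def)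
qed

section \<open>Modular-width, degrees and the bound on \<open>ell\<close>\<close>

lemma flat_modular_decomposition:
  assumes "finite V" "V \<noteq> {}"
  shows "\<exists>T. modular_decomposition V E T \<and> tree_width T \<le> card V"
proof -
  obtain xs where xs: "set xs = V" "distinct xs" using finite_distinct_list[OF assms(1)] by blast
  let ?F = "{{i, j} | i j. i < length xs \<and> j < length xs \<and> i \<noteq> j \<and> {xs ! i, xs ! j} \<in> E}"
  let ?T = "Node (map Leaf xs) ?F"
  have "leaves ?T = xs" by (simp add: comp_def)
  moreover have "simple_graph {..<length xs} ?F" by (auto simp: simple_graph_def)
  moreover have "{i, j} \<in> ?F \<longleftrightarrow> {xs ! i, xs ! j} \<in> E" if "i < length xs" "j < length xs" "i \<noteq> j" for i j
    using that by (auto simp: doubleton_eq_iff insert_commute)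
  ultimately have "modular_decomposition V E ?T"
    using xs assms by (auto simp: modular_decomposition_def)
  moreover have "tree_width ?T \<le> card V"
    using xs by (auto simp: distinct_card)
  ultimately show ?thesis by blast
qed

text \<open>A root with the two trees as children suffices, its quotient being an edge or two
  isolated vertices. The root has width 2, hence \<open>2 \<le> w\<close>.\<close>

lemma modular_decomposition_union:
  assumes T1: "modular_decomposition V1 E T1" "tree_width T1 \<le> w"
    and T2: "modular_decomposition V2 E T2" "tree_width T2 \<le> w"
    and V: "V1 \<inter> V2 = {}" "V1 \<noteq> {}" "V2 \<noteq> {}" and w: "2 \<le> w"
    and E: "(\<forall>u\<in>V1. \<forall>v\<in>V2. {u, v} \<in> E) \<or> (\<forall>u\<in>V1. \<forall>v\<in>V2. {u, v} \<notin> E)"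
  shows "\<exists>T. modular_decomposition (V1 \<union> V2) E T \<and> tree_width T \<le> w"
proof -
  define F :: "nat set set" where "F = (if \<forall>u\<in>V1. \<forall>v\<in>V2. {u, v} \<in> E then {{0, 1}} else {})"
  let ?T = "Node [T1, T2] F"
  have E': "(\<forall>u\<in>V2. \<forall>v\<in>V1. {u, v} \<in> E) \<longleftrightarrow> (\<forall>u\<in>V1. \<forall>v\<in>V2. {u, v} \<in> E)"
    "(\<forall>u\<in>V2. \<forall>v\<in>V1. {u, v} \<notin> E) \<longleftrightarrow> (\<forall>u\<in>V1. \<forall>v\<in>V2. {u, v} \<notin> E)"
    by (metis insert_commute)+
  have F: "{0, 1} \<in> F \<longleftrightarrow> (\<forall>u\<in>V1. \<forall>v\<in>V2. {u, v} \<in> E)" "{0, 1} \<notin> F \<longleftrightarrow> (\<forall>u\<in>V1. \<forall>v\<in>V2. {u, v} \<notin> E)"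
    using E V by (auto simp: F_def)
  have comm: "{1, 0} = {0, 1 :: nat}" by auto
  have leaves: "set (leaves T1) = V1" "set (leaves T2) = V2"
    using T1 T2 by (auto simp: modular_decomposition_def)
  have "simple_graph {..<length [T1, T2]} F" by (auto simp: F_def simple_graph_def)
  moreover have q: "({i, j} \<in> F \<longleftrightarrow>
        (\<forall>u\<in>set (leaves ([T1, T2] ! i)). \<forall>v\<in>set (leaves ([T1, T2] ! j)). {u, v} \<in> E)) \<and>
      ({i, j} \<notin> F \<longleftrightarrow>
        (\<forall>u\<in>set (leaves ([T1, T2] ! i)). \<forall>v\<in>set (leaves ([T1, T2] ! j)). {u, v} \<notin> E))"
    if "i < length [T1, T2]" "j < length [T1, T2]" "i \<noteq> j" for i j
  proof -
    have "(i = 0 \<and> j = 1) \<or> (i = 1 \<and> j = 0)" using that by auto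
    then show ?thesis
    proof
      assume "i = 0 \<and> j = 1"
      then show ?thesis using F leaves by simp
    next
      assume "i = 1 \<and> j = 0"
      then show ?thesis using F E' leaves comm by simp
    qed
  qed
  ultimately have "quotients_ok E ?T"
    unfolding quotients_ok.simps
  proof (intro conjI)
    show "\<forall>t\<in>set [T1, T2]. quotients_ok E t" using T1 T2 by (simp add: modular_decomposition_def)
  qed (use q in \<open>blast+\<close>)
  then have "modular_decomposition (V1 \<union> V2) E ?T"
    using T1 T2 V by (simp add: modular_decomposition_def del: quotients_ok.simps)
  moreover have "tree_width ?T \<le> w" using T1 T2 w by simp
  ultimately show ?thesis by blast
qed

text \<open>The graph is built from \<open>G\<close>, the new vertices and the isolated vertices by
  one full join and one disjoint union; each piece has at most \<open>n\<close> vertices and gets a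
  flat tree. The alternative \<open>V = {}\<close> in \<open>?P\<close> is there because an empty
  vertex set has no decomposition.\<close>

lemma mw_reduction_le:
  assumes G: "G \<subseteq> {..<n}" and n: "2 \<le> n" "k \<le> n"
  shows "mw {..<n + (k - d)} (reduction_edges n (n + (k - d)) E G) \<le> n"
proof -
  let ?m = "n + (k - d)"
  let ?E = "reduction_edges n ?m E G"
  let ?P = "\<lambda>V. V = {} \<or> (\<exists>T. modular_decomposition V ?E T \<and> tree_width T \<le> n)"
  have flat: "?P V" if "finite V" "card V \<le> n" for V
    using flat_modular_decomposition[of V ?E] that order_trans by blast
  have union: "?P (V1 \<union> V2)"
    if "?P V1" "?P V2" "V1 \<inter> V2 = {}"
      "(\<forall>u\<in>V1. \<forall>v\<in>V2. {u, v} \<in> ?E) \<or> (\<forall>u\<in>V1. \<forall>v\<in>V2. {u, v} \<notin> ?E)" for V1 V2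
  proof (cases "V1 = {} \<or> V2 = {}")
    case False
    then show ?thesis using that modular_decomposition_union[OF _ _ _ _ that(3) _ _ n(1) that(4)] by blast
  qed (use that in auto)
  have fin: "card G \<le> n" "finite G"
    using G card_mono[of "{..<n}" G] finite_subset[of G "{..<n}"] by auto
  have G_X: "?P (G \<union> {n..<?m})"
  proof (rule union)
    show "?P G" by (rule flat[OF fin(2,1)])
    show "?P {n..<?m}" using n(2) by (intro flat) auto
  qed (use G in \<open>auto simp: reduction_edges_iff\<close>)
  have "?P ((G \<union> {n..<?m}) \<union> ({..<n} - G))"
  proof (rule union[OF G_X])
    show "?P ({..<n} - G)" using card_mono[of "{..<n}" "{..<n} - G"] by (intro flat) auto
  qed (use G in \<open>auto simp: reduction_edges_iff\<close>)
  moreover have "(G \<union> {n..<?m}) \<union> ({..<n} - G) = {..<?m}" using G by auto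
  moreover have "0 \<in> {..<?m}" using n by simp
  ultimately obtain T where "modular_decomposition {..<?m} ?E T" "tree_width T \<le> n"
    by (metis empty_iff)
  then show ?thesis unfolding mw_def
    by (intro order_trans[OF Least_le[of _ "tree_width T"]]) auto
qed

text \<open>A vertex of \<open>G\<close> has at least \<open>k - 1\<close> neighbours in
  \<open>E\<close>, hence at most \<open>n - (k - 1)\<close> in the complement. The
  \<open>k - d\<close> new ones bring this to \<open>n + 1 - d\<close>, which is at most
  \<open>n\<close> by \<open>1 \<le> d\<close>. New vertices only see \<open>G\<close>.\<close>

lemma degree_reduction_high_degree:
  assumes k: "1 \<le> d" "d \<le> k" "k \<le> n" and v: "v < n + (k - d)"
  shows "card {u \<in> {..<n + (k - d)}. {u, v} \<in> reduction_edges n (n + (k - d)) E (high_degree n E k)} \<le> n"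
proof -
  let ?m = "n + (k - d)" and ?G = "high_degree n E k"
  let ?N = "{u \<in> {..<?m}. {u, v} \<in> reduction_edges n ?m E ?G}"
  have G: "?G \<subseteq> {..<n}" by (auto simp: high_degree_def)
  consider "v \<in> ?G" | "v < n" "v \<notin> ?G" | "n \<le> v" by (meson not_le)
  then show ?thesis
  proof cases
    case 1
    let ?A = "{u. u < n \<and> {v, u} \<in> E} - {v}" and ?B = "{u. u < n \<and> u \<noteq> v \<and> {v, u} \<notin> E}"
    have v: "v < n" "k \<le> card {u. u < n \<and> {v, u} \<in> E} + 1" using 1 by (auto simp: high_degree_def)
    have "?N \<subseteq> ?B \<union> {n..<?m}" using 1 G by (auto simp: reduction_edges_iff insert_commute)
    then have "card ?N \<le> card (?B \<union> {n..<?m})" by (intro card_mono) auto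
    also have "\<dots> \<le> card ?B + (k - d)" using card_Un_le[of ?B "{n..<?m}"] by simp
    finally have 2: "card ?N \<le> card ?B + (k - d)" .
    have "card {u. u < n \<and> {v, u} \<in> E} + card ?B = card ({u. u < n \<and> {v, u} \<in> E} \<union> ?B)"
      by (subst card_Un_disjoint) auto
    also have "\<dots> \<le> card {..<n}" by (intro card_mono) auto
    finally have "card {u. u < n \<and> {v, u} \<in> E} + card ?B \<le> n" by simp
    then show ?thesis using 2 v(2) k by linarith
  next
    case 2
    then have "?N = {}" by (auto simp: reduction_edges_iff)
    then show ?thesis by (simp only: card.empty)
  next
    case 3
    then have "?N \<subseteq> {..<n}" using G by (auto simp: reduction_edges_iff)
    then show ?thesis using card_mono[of "{..<n}" ?N] by simp
  qed
qed

text \<open>The degree is the only term that may exceed \<open>n\<close>; \<open>N\<close> will be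
  \<open>n\<close> when low-degree vertices are isolated and \<open>2 * n\<close> otherwise.\<close>

lemma ell_reduction_le:
  assumes G: "G \<subseteq> {..<n}" and n: "2 \<le> n" "d \<le> k" "k \<le> n" and N: "n \<le> N"
    and deg: "\<And>v. v < n + (k - d) \<Longrightarrow>
      card {u \<in> {..<n + (k - d)}. {u, v} \<in> reduction_edges n (n + (k - d)) E G} \<le> N"
  shows "ell (reduction n E k d G) \<le> real N"
proof -
  let ?m = "n + (k - d)"
  let ?E = "reduction_edges n ?m E G"
  have "real (2 * k - d) = 2 * real k - real d" "real ?m = real n + real k - real d"
    using n by (simp_all add: of_nat_diff)
  then have "real ?m - (real (2 * k - d) - real d) / 2 = real n" by (simp add: field_simps)
  moreover have "max_degree {..<?m} ?E \<le> N" 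
    unfolding max_degree_def
  proof (rule Max.boundedI)
    have "0 \<in> {..<?m}" using n by simp
    then show "(\<lambda>v. card {u \<in> {..<?m}. {u, v} \<in> ?E}) ` {..<?m} \<noteq> {}" by blast
  qed (use deg in auto)
  moreover have S: "card G \<le> n" using card_mono[of "{..<n}" G] G by simp
  moreover have "vc {..<?m} ?E \<le> card G"
  proof -
    have "vertex_cover {..<?m} ?E G" using G by (intro vertex_cover_kept) auto
    then show ?thesis unfolding vc_def by (blast intro: Least_le)
  qed
  moreover have "mw {..<?m} ?E \<le> n" using mw_reduction_le[OF G n(1,3)] .
  ultimately show ?thesis using N unfolding ell_def reduction_def
    by (simp only: prod.case) (rule Max.boundedI, auto)
qed

section \<open>Running times\<close>

lemma abs_le_input_size: "x \<in> set inp \<Longrightarrow> \<bar>x\<bar> \<le> int (input_size inp)"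
proof -
  assume "x \<in> set inp"
  then have "\<bar>x\<bar> \<le> Max (insert 0 (abs ` set inp))" by (intro Max_ge) auto
  then show ?thesis unfolding input_size_def by linarith
qed

lemma input_size_le:
  assumes "\<And>x. x \<in> set inp \<Longrightarrow> \<bar>x\<bar> \<le> int B"
  shows "input_size inp \<le> length inp + B"
proof -
  have "Max (insert 0 (abs ` set inp)) \<le> int B" using assms by (subst Max_le_iff) auto
  then show ?thesis unfolding input_size_def by linarith
qed

lemma input_size_clique_encode:
  "n * n + 2 \<le> input_size (clique_encode n E k)"
  "n \<le> input_size (clique_encode n E k)" "k \<le> input_size (clique_encode n E k)"
proof -
  show "n * n + 2 \<le> input_size (clique_encode n E k)"
    by (simp add: input_size_def clique_encode_def length_adjacency_matrix)
  have "int n \<in> set (clique_encode n E k)" "int k \<in> set (clique_encode n E k)"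
    by (simp_all add: clique_encode_def)
  from this[THEN abs_le_input_size]
  show "n \<le> input_size (clique_encode n E k)" "k \<le> input_size (clique_encode n E k)" by simp_all
qed

text \<open>The reduced input is never written down, but the word bound of the gap algorithm refers
  to its size. With \<open>m \<le> 2 * n\<close> vertices that is polynomial in the size of the
  clique input.\<close>

lemma input_size_reduction_le:
  assumes "d \<le> k" "k \<le> n"
  shows "input_size (gap_encode (reduction n E k d G)) \<le> 8 * (n * n + 1)"
proof -
  let ?g = "gap_encode (reduction n E k d G)"
  have adj: "\<bar>x\<bar> \<le> 1" if "x \<in> set (adjacency_matrix m F)" for x m F
    using that by (auto simp: adjacency_matrix_def)
  have "\<bar>x\<bar> \<le> int (2 * n + 1)" if "x \<in> set ?g" for x
    using that assms by (auto simp: gap_encode_def reduction_def split: if_splits dest!: adj)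
  from input_size_le[OF this] have "input_size ?g \<le> length ?g + (2 * n + 1)" .
  moreover define m where "m = n + (k - d)"
  have "length ?g = 3 + m + m * m"
    by (simp add: gap_encode_def reduction_def length_adjacency_matrix m_def)
  moreover have m: "m \<le> 2 * n" using assms by (simp add: m_def)
  then have "m * m \<le> (2 * n) * (2 * n)" by (intro mult_mono) auto
  then have "m * m \<le> 4 * (n * n)" by simp
  moreover have "n \<le> n * n" by simp
  ultimately have "input_size ?g \<le> 8 * (n * n) + 8" using m by linarith
  then show ?thesis by simp
qed

section \<open>Asymptotic bounds\<close>

lemma eventually_large_instances:
  "eventually Q (large_instances P) \<longleftrightarrow> (\<exists>N. \<forall>x\<in>instances P. N \<le> dimension P x \<longrightarrow> Q x)"
  unfolding large_instances_def eventually_inf_principal eventually_filtercomap_at_top_linorder by auto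

text \<open>The real \<open>c\<close> need not be computable, but the program only has to compare
  \<open>k\<close> with the constant \<open>k0\<close>, the ceiling of \<open>2 / c\<close>. For
  \<open>c = 0\<close> the exponent is always bounded and the test is constantly positive.\<close>

lemma powr_bounded_or_ge:
  assumes "0 \<le> (c::real)"
  shows "\<exists>\<alpha> \<beta> A. \<forall>k::nat. (\<alpha> - \<beta> * int k > 0 \<longrightarrow> c * real k \<le> A) \<and> (\<not> \<alpha> - \<beta> * int k > 0 \<longrightarrow> 2 \<le> c * real k)"
proof (cases "c = 0")
  case True
  then show ?thesis by (intro exI[of _ 1] exI[of _ 0] exI[of _ 0]) auto
next
  case False
  define k0 where "k0 = nat \<lceil>2 / c\<rceil>"
  have "2 / c \<le> real k0" unfolding k0_def by linarith
  then have k0: "2 \<le> c * real k0" using False assms by (simp add: field_simps)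
  have "c * real k \<le> c * real k0" if "k \<le> k0" for k using that assms by (intro mult_left_mono) auto
  moreover have "2 \<le> c * real k" if "k0 \<le> k" for k
    using that assms k0 order_trans[OF k0 mult_left_mono[of "real k0" "real k" c]] by simp
  ultimately show ?thesis
    by (intro exI[of _ "int k0 + 1"] exI[of _ 1] exI[of _ "c * real k0"]) auto
qed

text \<open>Fix some \<open>k\<close> in \<open>K\<close> and take edgeless graphs with empty cover.
  Then \<open>ell\<close> is at least \<open>n - (k - d) / 2\<close> and tends to infinity, so the
  time bound drops below 1; a program that halts after 0 steps has written nothing, yet no correct
  answer is empty.\<close>

lemma gap_solver_negative_exponent:
  fixes P :: "gap_instance problem"
  assumes P: "instances P = gap_instances (K \<times> {d})" "encode P = gap_encode"
      "dimension P = (\<lambda>(n, E, S, k, d). n)"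
    and nonempty: "\<And>x out. x \<in> instances P \<Longrightarrow> correct P x out \<Longrightarrow> out \<noteq> []"
    and sol: "solvable_in_time P (\<lambda>(n, E, S, k, d). ell (n, E, S, k, d) powr (c * ((real k + real d) / 2)))"
    and d: "1 \<le> d" "\<forall>k\<in>K. d \<le> k" and c: "c < 0"
  shows "K = {}"
proof (rule ccontr)
  assume "K \<noteq> {}"
  then obtain k where k: "k \<in> K" "d \<le> k" using d by blast
  define e where "e = c * ((real k + real d) / 2)"
  have e: "e < 0" using c d k by (simp add: e_def mult_neg_pos)
  obtain p where p: "\<forall>x\<in>instances P. correct P x (result p (encode P x))"
    and O: "(\<lambda>x. real (run_time p (encode P x))) \<in> O[large_instances P](\<lambda>(n, E, S, k, d). ell (n, E, S, k, d) powr (c * ((real k + real d) / 2)))"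
    using sol unfolding solvable_in_time_def by blast
  obtain C where C: "C > 0" "eventually (\<lambda>x. norm (real (run_time p (encode P x))) \<le> C * norm
       (case x of (n, E, S, k, d) \<Rightarrow> ell (n, E, S, k, d) powr (c * ((real k + real d) / 2)))) (large_instances P)"
    using landau_o.bigE[OF O] by blast
  then obtain N where N: "\<forall>x\<in>instances P. N \<le> dimension P x \<longrightarrow> norm (real (run_time p (encode P x))) \<le> C * norm
       (case x of (n, E, S, k, d) \<Rightarrow> ell (n, E, S, k, d) powr (c * ((real k + real d) / 2)))"
    unfolding eventually_large_instances by blast
  let ?z = "\<lambda>n. real n - (real k - real d) / 2"
  have z: "filterlim ?z at_top sequentially"
    using filterlim_tendsto_add_at_top[OF tendsto_const[of "- ((real k - real d) / 2)"] filterlim_real_sequentially]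
    by simp
  have "((\<lambda>n. C * ?z n powr e) \<longlongrightarrow> C * 0) sequentially"
    by (intro tendsto_intros tendsto_neg_powr[OF e z])
  then have "eventually (\<lambda>n. C * ?z n powr e < 1) sequentially" by (simp add: order_tendstoD(2))
  moreover have "eventually (\<lambda>n. 0 < ?z n) sequentially"
    using z unfolding filterlim_at_top_dense by blast
  ultimately have "eventually (\<lambda>n. C * ?z n powr e < 1 \<and> 0 < ?z n \<and> N \<le> n) sequentially"
    using eventually_ge_at_top[of N] by eventually_elim auto
  then obtain n where n: "C * ?z n powr e < 1" "0 < ?z n" "N \<le> n"
    using eventually_happens'[OF sequentially_bot] by blast
  let ?x = "(n, {}, {}, k, d) :: gap_instance"
  have x: "?x \<in> instances P"
    using k d by (auto simp: P gap_instances_def simple_graph_def vertex_cover_def)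
  have "?z n \<le> ell ?x" by (simp add: ell_def)
  then have "ell ?x powr e \<le> ?z n powr e" using e n by (intro powr_mono2') auto
  then have "C * ell ?x powr e < 1" 
    using n(1) C(1) mult_left_mono[of "ell ?x powr e" "?z n powr e" C] by linarith
  moreover have "real (run_time p (encode P ?x)) \<le> C * ell ?x powr e"
    using N x n(3) by (auto simp: P e_def)
  ultimately have "run_time p (encode P ?x) = 0" by simp
  then have "result p (encode P ?x) = []" by (simp add: result_def config_after_def)
  then show False using nonempty[OF x] p x by metis
qed

text \<open>The last assumption is all that is used about the answer of the gap algorithm, and both
  versions of the problem satisfy it. In \<open>c1\<close>, the part \<open>4 * c0\<close> covers
  the words of the simulated program, \<open>length p\<close> its program counter, 1 the clique
  input; the last factor comes from compilation.\<close>

lemma clique_com_instance: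
  fixes n E k d p \<alpha> \<beta> c0
  defines "cc \<equiv> clique_com p d \<alpha> \<beta>" and "inp \<equiv> clique_encode n E k"
    and "G \<equiv> kept \<alpha> \<beta> n E k"
  defines "g \<equiv> gap_encode (reduction n E k d G)"
    and "c1 \<equiv> (4 * c0 + length p + 1) * (com_weight (clique_com p d \<alpha> \<beta>) + 1)"
  assumes d: "1 \<le> d" "d \<le> k"
    and p: "terminates p g" "word_bounded c0 p g"
    and x: "\<exists>x xs. result p g = x # xs \<and>
      (x = 1 \<and> (\<exists>Y. vertex_cover {..<n + (k - d)} (reduction_edges n (n + (k - d)) E G) Y \<and>
                 int (card G) - int (card Y) \<ge> int d) \<or>
       x = 0 \<and> \<not> has_improving_swap {..<n + (k - d)} (reduction_edges n (n + (k - d)) E G) G (2 * k - d) d)"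
  shows "terminates (comp_com 0 cc) inp" "word_bounded c1 (comp_com 0 cc) inp"
    and "decides (\<exists>C. is_clique {..<n} E C \<and> card C = k) (result (comp_com 0 cc) inp)"
    and "n < k \<Longrightarrow> run_time (comp_com 0 cc) inp \<le> cost cc * 4"
    and "k \<le> n \<Longrightarrow> run_time (comp_com 0 cc) inp \<le> cost cc *
      ((if \<alpha> - \<beta> * int k > 0 then 0 else (3 * n + 6) * n) + (length p + 5) * run_time p g + 6)"
proof -
  let ?q = "4 * c0 + length p + 1"
  let ?clique = "\<exists>C. is_clique {..<n} E C \<and> card C = k"
  \<comment> \<open>The word bound must be fixed before the run is known, so it uses the time of the
    simulated program, a lower bound for the time of the simulator. For \<open>n < k\<close> nothing
    is simulated.\<close>
  define T where "T = (if n < k then 0 else run_time p g)"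
  define X where "X = input_size inp + T + 2"
  define b where "b = int X ^ ?q"
  have X: "2 \<le> int X" "n \<le> X" "k \<le> X" "n * n + 2 \<le> input_size inp" "input_size inp \<le> X"
    using input_size_clique_encode[where n = n and E = E and k = k] by (auto simp: X_def inp_def)
  have "int X ^ 1 \<le> b" unfolding b_def using X by (intro power_increasing) auto
  then have b: "2 \<le> b" "int n \<le> b" "int k \<le> b" "1 \<le> b" using X by auto
  have inp_b: "\<forall>x\<in>set inp. \<bar>x\<bar> \<le> b"
  proof
    fix x assume "x \<in> set inp"
    then show "\<bar>x\<bar> \<le> b" using abs_le_input_size[of x inp] X(5) \<open>int X ^ 1 \<le> b\<close> by simp
  qed
  have Lb: "int (length p) \<le> b"
  proof -
    have "int (length p) \<le> int X ^ length p" using abs_le_power[OF X(1), of "int (length p)"] by simp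
    also have "\<dots> \<le> b" unfolding b_def using X by (intro power_increasing) auto
    finally show ?thesis .
  qed
  have "\<exists>t H out. big inp b cc (\<lambda>_. 0) [] t H out \<and> T \<le> t \<and> decides ?clique out \<and>
     (n < k \<longrightarrow> t \<le> 4) \<and> (k \<le> n \<longrightarrow> t \<le> (if \<alpha> - \<beta> * int k > 0 then 0 else (3 * n + 6) * n) +
       (length p + 5) * run_time p g + 6)"
  proof (cases "n < k")
    case True
    have "\<not> ?clique"
    proof
      assume ?clique
      then obtain C where "C \<subseteq> {..<n}" "card C = k" by (auto simp: is_clique_def)
      then show False using card_mono[of "{..<n}" C] True by simp
    qed
    then have "decides ?clique [0]" by (simp add: decides_def)
    then show ?thesis using clique_com_large[OF b(2,3) True, of E p d \<alpha> \<beta>] True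
      unfolding cc_def inp_def T_def by (auto simp del: split_paired_Ex)
  next
    case False
    then have k: "k \<le> n" by simp
    have T: "T = run_time p g" using False by (simp add: T_def)
    have "input_size g \<le> 8 * (n * n + 1)"
      unfolding g_def using d k by (intro input_size_reduction_le) auto
    then have "input_size g + T + 2 \<le> 8 * X" using X(4) by (simp add: X_def)
    also have "\<dots> = 2 ^ 3 * X" by simp
    \<comment> \<open>\<open>X \<ge> 2\<close> turns the constant 8 into a power of
      \<open>X\<close>, since the word bound has no room for constant factors.\<close>
    also have "\<dots> \<le> X ^ 3 * X" using X(1) by (intro mult_right_mono power_mono) auto
    also have "\<dots> = X ^ 4" by (simp add: eval_nat_numeral mult_ac)
    finally have "(input_size g + T + 2) ^ c0 \<le> (X ^ 4) ^ c0" by (intro power_mono) auto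
    also have "\<dots> \<le> X ^ ?q" unfolding power_mult[symmetric] using X(1) by (intro power_increasing) auto
    finally have "int ((input_size g + T + 2) ^ c0) \<le> b" unfolding b_def by (metis of_nat_le_iff of_nat_power)
    then have bd: "bounded_by b (fst (snd (config_after p g s)))" for s
      using p(2) T unfolding word_bounded_def bounded_by_def by (meson order_trans)
    obtain t H where t: "big inp b cc (\<lambda>_. 0) [] t H (take 1 (result p g))" "T \<le> t"
      "t \<le> (if \<alpha> - \<beta> * int k > 0 then 0 else (3 * n + 6) * n) + (length p + 5) * run_time p g + 6"
      using clique_com_correct[OF b(2,4) Lb k d(2), of E \<alpha> \<beta>] p(1) bd
      unfolding cc_def inp_def T g_def G_def by blast
    obtain x xs where out: "result p g = x # xs"
      and cases: "x = 1 \<and> (\<exists>Y. vertex_cover {..<n + (k - d)} (reduction_edges n (n + (k - d)) E G) Y \<and>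
                 int (card G) - int (card Y) \<ge> int d) \<or>
       x = 0 \<and> \<not> has_improving_swap {..<n + (k - d)} (reduction_edges n (n + (k - d)) E G) G (2 * k - d) d"
      using x by blast
    have G: "G \<subseteq> {..<n}" unfolding G_def by (rule kept_subset)
    from cases have "x = (if ?clique then 1 else 0)"
    proof
      assume "x = 1 \<and> (\<exists>Y. vertex_cover {..<n + (k - d)} (reduction_edges n (n + (k - d)) E G) Y \<and>
                 int (card G) - int (card Y) \<ge> int d)"
      then show ?thesis using smaller_cover_imp_clique[OF _ _ G d] by auto
    next
      assume a: "x = 0 \<and> \<not> has_improving_swap {..<n + (k - d)}
        (reduction_edges n (n + (k - d)) E G) G (2 * k - d) d"
      have "\<not> ?clique"
      proof
        assume ?clique
        then obtain C where C: "is_clique {..<n} E C" "card C = k" by blast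
        then have "C \<subseteq> G" unfolding G_def by (rule clique_subset_kept)
        from clique_imp_improving_swap[OF C this G d(2)] a show False by blast
      qed
      then show ?thesis using a by simp
    qed
    then have "decides ?clique (take 1 (result p g))" unfolding decides_def out by simp
    then show ?thesis using t False by blast
  qed
  then obtain t H out where t: "big inp b cc (\<lambda>_. 0) [] t H out" "T \<le> t" "decides ?clique out"
    "n < k \<Longrightarrow> t \<le> 4" "k \<le> n \<Longrightarrow> t \<le> (if \<alpha> - \<beta> * int k > 0 then 0 else (3 * n + 6) * n) +
       (length p + 5) * run_time p g + 6" by blast
  note run = compiled_program[OF t(1) b(1) inp_b]
  show "terminates (comp_com 0 cc) inp" by (rule run)
  show "decides ?clique (result (comp_com 0 cc) inp)" using run(2) t(3) by simp
  show "run_time (comp_com 0 cc) inp \<le> cost cc * 4" if "n < k"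
    using run(4) mult_le_mono2[OF t(4)[OF that], of "cost cc"] by linarith
  show "run_time (comp_com 0 cc) inp \<le> cost cc *
      ((if \<alpha> - \<beta> * int k > 0 then 0 else (3 * n + 6) * n) + (length p + 5) * run_time p g + 6)" if "k \<le> n"
    using order_trans[OF run(4) mult_le_mono2[OF t(5)[OF that], of "cost cc"]] .
  show "word_bounded c1 (comp_com 0 cc) inp"
    unfolding word_bounded_def
  proof (intro allI)
    fix s a
    have "\<bar>fst (snd (config_after (comp_com 0 cc) inp s)) a\<bar> \<le> b ^ (com_weight cc + 1)" by (rule run(5))
    also have "\<dots> = int (X ^ c1)" unfolding b_def c1_def cc_def by (simp only: of_nat_power power_mult)
    also have "\<dots> \<le> int ((input_size inp + run_time (comp_com 0 cc) inp + 2) ^ c1)"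
      using t(2) run(3) by (simp only: of_nat_le_iff) (intro power_mono, auto simp: X_def)
    finally show "\<bar>fst (snd (config_after (comp_com 0 cc) inp s)) a\<bar>
      \<le> int ((input_size inp + run_time (comp_com 0 cc) inp + 2) ^ c1)" .
  qed
qed

text \<open>The program built here contains \<open>d\<close> and the two threshold constants as
  literals, while \<open>k\<close> is read from the input; thus one program serves all clique sizes
  that come from \<open>K\<close>.\<close>

lemma clique_solvable_of_gap_solvable:
  fixes P :: "gap_instance problem" and c :: real
  assumes P: "instances P = gap_instances (K \<times> {d})" "encode P = gap_encode"
      "dimension P = (\<lambda>(n, E, S, k, d). n)"
    and correct: "\<And>n E S k out. (n, E, S, k, d) \<in> instances P \<Longrightarrow> correct P (n, E, S, k, d) out \<Longrightarrow>
      \<exists>x xs. out = x # xs \<and>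
        (x = 1 \<and> (\<exists>Y. vertex_cover {..<n} E Y \<and> int (card S) - int (card Y) \<ge> int d) \<or>
         x = 0 \<and> \<not> has_improving_swap {..<n} E S k d)"
    and sol: "solvable_in_time P (\<lambda>(n, E, S, k, d). ell (n, E, S, k, d) powr (c * ((real k + real d) / 2)))"
    and d: "1 \<le> d" "\<forall>k\<in>K. d \<le> k"
  shows "solvable_in_time (clique_problem {k'. \<exists>k\<in>K. 2 * k' = k + d}) (\<lambda>(n, E, k). real n powr (c * real k))"
    (is "solvable_in_time ?Q ?f")
proof (cases "c < 0")
  case True
  have "out \<noteq> []" if "x \<in> instances P" "correct P x out" for x out
  proof -
    obtain n E S k d' where x: "x = (n, E, S, k, d')" using prod_cases5 by blast
    then have "d' = d" using that(1) by (simp add: P gap_instances_def)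
    with x show ?thesis using correct that by blast
  qed
  from gap_solver_negative_exponent[OF P this sol d True] have "K = {}" .
  \<comment> \<open>Without parameters there are no clique instances, and any program solves the
    problem.\<close>
  then have empty: "instances ?Q = {}" by (simp add: clique_problem_def)
  then have "eventually R (large_instances ?Q)" for R by (simp add: eventually_large_instances)
  then have "h \<in> O[large_instances ?Q](?f)" for h by (intro bigoI[where c = 1])
  then show ?thesis using empty unfolding solvable_in_time_def by blast
next
  case False
  then have c: "0 \<le> c" by simp
  obtain p c0 where p: "\<And>x. x \<in> instances P \<Longrightarrow> terminates p (encode P x) \<and>
      word_bounded c0 p (encode P x) \<and> correct P x (result p (encode P x))"
    and O: "(\<lambda>x. real (run_time p (encode P x))) \<in> O[large_instances P](\<lambda>(n, E, S, k, d). ell (n, E, S, k, d) powr (c * ((real k + real d) / 2)))"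
    using sol unfolding solvable_in_time_def by blast
  obtain C where C: "C > 0" "eventually (\<lambda>x. norm (real (run_time p (encode P x))) \<le> C * norm
       (case x of (n, E, S, k, d) \<Rightarrow> ell (n, E, S, k, d) powr (c * ((real k + real d) / 2)))) (large_instances P)"
    using landau_o.bigE[OF O] by blast
  then obtain N where N: "\<forall>x\<in>instances P. N \<le> dimension P x \<longrightarrow> norm (real (run_time p (encode P x))) \<le> C * norm
       (case x of (n, E, S, k, d) \<Rightarrow> ell (n, E, S, k, d) powr (c * ((real k + real d) / 2)))"
    unfolding eventually_large_instances by blast
  obtain \<alpha> \<beta> A where A: "\<And>k::nat. \<alpha> - \<beta> * int k > 0 \<Longrightarrow> c * real k \<le> A"
    "\<And>k::nat. \<not> \<alpha> - \<beta> * int k > 0 \<Longrightarrow> 2 \<le> c * real k"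
    using powr_bounded_or_ge[OF c] by blast
  define cc where "cc = clique_com p d \<alpha> \<beta>"
  define c1 where "c1 = (4 * c0 + length p + 1) * (com_weight cc + 1)"
  \<comment> \<open>\<open>2 powr A\<close> absorbs the factor from \<open>ell \<le> 2 * n\<close>
    when the exponent is bounded; the maximum with 1 covers the case
    \<open>ell \<le> n\<close>.\<close>
  define B where "B = max 1 (2 powr A)"
  \<comment> \<open>12 is 6 for the table plus the additive 6, and it also dominates the 4 of the
    case \<open>n < k\<close>.\<close>
  define D where "D = real (cost cc) * (12 + (real (length p) + 5) * (C * B))"
  let ?red = "\<lambda>n E k. reduction n E k d (kept \<alpha> \<beta> n E k)"
  have red: "?red n E k \<in> instances P" "d \<le> k"
    if "(n, E, k) \<in> instances ?Q" for n E k
  proof -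
    from that obtain k1 where k1: "k1 \<in> K" "2 * k = k1 + d"
      by (auto simp: clique_problem_def)
    have "d \<le> k1" using d k1 by blast
    then show k: "d \<le> k" using k1 by auto
    have "2 * k - d = k1" using k1 by simp
    then show "?red n E k \<in> instances P"
      unfolding P using k1 d k by (intro reduction_in_gap_instances kept_subset) auto
  qed
  have inst: "terminates (comp_com 0 cc) (clique_encode n E k)"
    "word_bounded c1 (comp_com 0 cc) (clique_encode n E k)"
    "decides (\<exists>C. is_clique {..<n} E C \<and> card C = k) (result (comp_com 0 cc) (clique_encode n E k))"
    "n < k \<Longrightarrow> run_time (comp_com 0 cc) (clique_encode n E k) \<le> cost cc * 4"
    "k \<le> n \<Longrightarrow> run_time (comp_com 0 cc) (clique_encode n E k) \<le> cost cc *
      ((if \<alpha> - \<beta> * int k > 0 then 0 else (3 * n + 6) * n) +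
       (length p + 5) * run_time p (gap_encode (?red n E k)) + 6)"
    if nEk: "(n, E, k) \<in> instances ?Q" for n E k
  proof -
    note r = p[OF red(1)[OF nEk], unfolded P]
    have "correct P (?red n E k) (result p (gap_encode (?red n E k)))" using r by simp
    from correct[OF red(1)[OF nEk, unfolded reduction_def] this[unfolded reduction_def]] r
    show "terminates (comp_com 0 cc) (clique_encode n E k)"
      "word_bounded c1 (comp_com 0 cc) (clique_encode n E k)"
      "decides (\<exists>C. is_clique {..<n} E C \<and> card C = k) (result (comp_com 0 cc) (clique_encode n E k))"
      "n < k \<Longrightarrow> run_time (comp_com 0 cc) (clique_encode n E k) \<le> cost cc * 4"
      "k \<le> n \<Longrightarrow> run_time (comp_com 0 cc) (clique_encode n E k) \<le> cost cc *
        ((if \<alpha> - \<beta> * int k > 0 then 0 else (3 * n + 6) * n) +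
         (length p + 5) * run_time p (gap_encode (?red n E k)) + 6)"
      using clique_com_instance[of d k p n E \<alpha> \<beta> c0] d(1) red(2)[OF nEk]
      unfolding cc_def c1_def reduction_def by blast+
  qed
  \<comment> \<open>\<open>N\<close> applies to the reduced instance, which has at least
    \<open>n\<close> vertices; 2 is needed for the modular-width bound and for
    \<open>3 * n + 6 \<le> 6 * n\<close>.\<close>
  have time: "real (run_time (comp_com 0 cc) (clique_encode n E k)) \<le> D * real n powr (c * real k)"
    if nEk: "(n, E, k) \<in> instances ?Q" and n: "max 2 N \<le> n" for n E k
  proof -
    let ?y = "real n powr (c * real k)"
    let ?t = "real (run_time p (gap_encode (?red n E k)))"
    have y: "1 \<le> ?y" using n c by (intro ge_one_powr_ge_zero) auto
    have B: "1 \<le> B" "2 powr A \<le> B" by (auto simp: B_def)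
    have D12: "real (cost cc) * 12 \<le> D" unfolding D_def using C B by (intro mult_left_mono) auto
    show ?thesis
    proof (cases "n < k")
      case True
      then have "real (run_time (comp_com 0 cc) (clique_encode n E k)) \<le> real (cost cc * 4)"
        using inst(4)[OF nEk] by (simp only: of_nat_le_iff)
      also have "\<dots> \<le> D" using D12 by simp
      also have "\<dots> \<le> D * ?y" using y D12 by (simp add: mult_le_cancel_left1)
      finally show ?thesis .
    next
      case False
      then have k: "k \<le> n" "d \<le> k" using red(2)[OF nEk] by auto
      let ?tab = "if \<alpha> - \<beta> * int k > 0 then 0 else (3 * n + 6) * n"
      have n2: "2 \<le> n" using n by simp
      have tab: "real ?tab \<le> 6 * ?y"
      proof (cases "\<alpha> - \<beta> * int k > 0")
        case False
        have "(3 * n + 6) * n \<le> 6 * n * n" using n2 by (intro mult_right_mono) auto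
        then have "real ((3 * n + 6) * n) \<le> real (6 * n * n)" by (simp only: of_nat_le_iff)
        also have "\<dots> = 6 * real n powr 2" using n2 by (simp add: power2_eq_square)
        also have "\<dots> \<le> 6 * ?y" using n2 A(2)[OF False] by (intro mult_left_mono powr_mono) auto
        finally show ?thesis using False by simp
      qed (use y in auto)
      have m: "c * ((real (2 * k - d) + real d) / 2) = c * real k" using k by (simp add: of_nat_diff)
      have "?t \<le> C * norm (ell (?red n E k) powr (c * real k))"
        using N red(1)[OF nEk] n m unfolding P reduction_def by force
      also have "\<dots> \<le> C * (B * ?y)"
      proof (intro mult_left_mono)
        have ell0: "0 \<le> ell (?red n E k)"
          by (simp add: ell_def reduction_def le_max_iff_disj)
        show "norm (ell (?red n E k) powr (c * real k)) \<le> B * ?y"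
        proof (cases "\<alpha> - \<beta> * int k > 0")
          case True
          have "ell (?red n E k) \<le> real (2 * n)"
          proof (rule ell_reduction_le[OF kept_subset n2 k(2,1)])
            fix v
            have "card {u \<in> {..<n + (k - d)}. {u, v} \<in> reduction_edges n (n + (k - d)) E (kept \<alpha> \<beta> n E k)}
              \<le> card {..<n + (k - d)}" by (intro card_mono) auto
            then show "card {u \<in> {..<n + (k - d)}. {u, v} \<in> reduction_edges n (n + (k - d)) E (kept \<alpha> \<beta> n E k)}
              \<le> 2 * n" using k by simp
          qed simp
          then have "ell (?red n E k) powr (c * real k) \<le> real (2 * n) powr (c * real k)"
            using ell0 c by (intro powr_mono2) auto
          also have "\<dots> = 2 powr (c * real k) * ?y" by (simp add: powr_mult)
          also have "\<dots> \<le> B * ?y"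
            using A(1)[OF True] B(2) by (intro mult_right_mono order_trans[OF powr_mono B(2)]) auto
          finally show ?thesis by simp
        next
          case tab: False
          have "ell (?red n E k) \<le> real n"
          proof (rule ell_reduction_le[OF kept_subset n2 k(2,1)])
            fix v assume "v < n + (k - d)"
            then show "card {u \<in> {..<n + (k - d)}. {u, v} \<in> reduction_edges n (n + (k - d)) E (kept \<alpha> \<beta> n E k)}
              \<le> n" using degree_reduction_high_degree[OF d(1) k(2,1)] tab by (simp add: kept_def)
          qed simp
          then have "ell (?red n E k) powr (c * real k) \<le> ?y" using ell0 c by (intro powr_mono2) auto
          also have "\<dots> \<le> B * ?y" using B(1) y by (simp add: mult_le_cancel_right1)
          finally show ?thesis by simp
        qed
      qed (use C in auto)
      finally have t: "?t \<le> C * B * ?y" by simp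
      have "real (run_time (comp_com 0 cc) (clique_encode n E k)) \<le>
          real (cost cc * (?tab + (length p + 5) * run_time p (gap_encode (?red n E k)) + 6))"
        using inst(5)[OF nEk k(1)] by (simp only: of_nat_le_iff)
      also have "\<dots> = real (cost cc) * (real ?tab + (real (length p) + 5) * ?t + 6)" by simp
      also have "\<dots> \<le> real (cost cc) * (6 * ?y + (real (length p) + 5) * (C * B * ?y) + 6 * ?y)"
        using tab t y by (intro mult_left_mono add_mono) auto
      also have "\<dots> = D * ?y" by (simp add: D_def algebra_simps)
      finally show ?thesis .
    qed
  qed
  have enc: "encode ?Q (n, E, k) = clique_encode n E k" for n E k
    by (simp add: clique_problem_def clique_encode_def)
  have dim: "dimension ?Q (n, E, k) = n" for n E k by (simp add: clique_problem_def)
  have cor: "correct ?Q (n, E, k) = decides (\<exists>C. is_clique {..<n} E C \<and> card C = k)" for n E k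
    by (simp add: clique_problem_def)
  have "(\<lambda>x. real (run_time (comp_com 0 cc) (encode ?Q x))) \<in> O[large_instances ?Q](?f)"
  proof (rule bigoI[where c = D])
    show "\<forall>\<^sub>F x in large_instances ?Q. norm (real (run_time (comp_com 0 cc) (encode ?Q x))) \<le> D * norm (?f x)"
      unfolding eventually_large_instances using time by (intro exI[of _ "max 2 N"]) (auto simp: enc dim)
  qed
  moreover have "\<forall>x\<in>instances ?Q. terminates (comp_com 0 cc) (encode ?Q x) \<and>
      word_bounded c1 (comp_com 0 cc) (encode ?Q x) \<and> correct ?Q x (result (comp_com 0 cc) (encode ?Q x))"
    using inst(1-3) by (auto simp: enc cor)
  ultimately show ?thesis unfolding solvable_in_time_def by blast
qed

text \<open>A singleton \<open>K\<close> gives the statement for one fixed \<open>k\<close>, an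
  infinite \<open>K\<close> the one with unbounded \<open>k\<close>. The clique sizes are exactly
  the integral values of \<open>(k + d) / 2\<close>.\<close>

theorem theorem11:
  fixes \<epsilon> :: real and d :: nat and K :: "nat set"
  assumes "\<epsilon> > 0"
    and "d \<ge> 1"
    and "\<forall>k\<in>K. d \<le> k"
  shows "(solvable_in_time (gap_ls_vertex_cover (K \<times> {d}))
            (\<lambda>(n, E, S, k, d). ell (n, E, S, k, d) powr ((omega / 3 - \<epsilon>) * ((real k + real d) / 2)))
          \<longrightarrow> solvable_in_time (clique_problem {k'. \<exists>k\<in>K. 2 * k' = k + d})
                (\<lambda>(n, E, k'). real n powr ((omega / 3 - \<epsilon>) * real k')))
       \<and> (solvable_in_time (permissive_gap_ls_vertex_cover (K \<times> {d}))
            (\<lambda>(n, E, S, k, d). ell (n, E, S, k, d) powr ((omega / 3 - \<epsilon>) * ((real k + real d) / 2)))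
          \<longrightarrow> solvable_in_time (clique_problem {k'. \<exists>k\<in>K. 2 * k' = k + d})
                (\<lambda>(n, E, k'). real n powr ((omega / 3 - \<epsilon>) * real k')))"
proof (intro conjI impI)
  assume sol: "solvable_in_time (gap_ls_vertex_cover (K \<times> {d}))
    (\<lambda>(n, E, S, k, d). ell (n, E, S, k, d) powr ((omega / 3 - \<epsilon>) * ((real k + real d) / 2)))"
  show "solvable_in_time (clique_problem {k'. \<exists>k\<in>K. 2 * k' = k + d})
    (\<lambda>(n, E, k'). real n powr ((omega / 3 - \<epsilon>) * real k'))"
  proof (rule clique_solvable_of_gap_solvable[OF _ _ _ _ sol assms(2,3)])
    fix n E S k out
    assume "(n, E, S, k, d) \<in> instances (gap_ls_vertex_cover (K \<times> {d}))"
      and out: "correct (gap_ls_vertex_cover (K \<times> {d})) (n, E, S, k, d) out"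
    then have "S \<subseteq> {..<n}" by (simp add: gap_ls_vertex_cover_def gap_instances_def vertex_cover_def)
    then show "\<exists>x xs. out = x # xs \<and>
        (x = 1 \<and> (\<exists>Y. vertex_cover {..<n} E Y \<and> int (card S) - int (card Y) \<ge> int d) \<or>
         x = 0 \<and> \<not> has_improving_swap {..<n} E S k d)"
      using out improving_swap_imp_smaller_cover[of "{..<n}" E S k d]
      by (auto simp: gap_ls_vertex_cover_def decides_def)
  qed (simp_all add: gap_ls_vertex_cover_def)
next
  assume sol: "solvable_in_time (permissive_gap_ls_vertex_cover (K \<times> {d}))
    (\<lambda>(n, E, S, k, d). ell (n, E, S, k, d) powr ((omega / 3 - \<epsilon>) * ((real k + real d) / 2)))"
  show "solvable_in_time (clique_problem {k'. \<exists>k\<in>K. 2 * k' = k + d})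
    (\<lambda>(n, E, k'). real n powr ((omega / 3 - \<epsilon>) * real k'))"
  proof (rule clique_solvable_of_gap_solvable[OF _ _ _ _ sol assms(2,3)])
    fix n E S k out
    assume "correct (permissive_gap_ls_vertex_cover (K \<times> {d})) (n, E, S, k, d) out"
    then show "\<exists>x xs. out = x # xs \<and>
        (x = 1 \<and> (\<exists>Y. vertex_cover {..<n} E Y \<and> int (card S) - int (card Y) \<ge> int d) \<or>
         x = 0 \<and> \<not> has_improving_swap {..<n} E S k d)"
      by (auto simp: permissive_gap_ls_vertex_cover_def)
  qed (simp_all add: permissive_gap_ls_vertex_cover_def)
qed

end
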